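(* The class $\mathfrak{MF}$ of MAT-free arrangements is properly contained in the class $\mathfrak{MF}'$ of MAT2-free arrangements: $\mathfrak{MF}\subsetneq\mathfrak{MF}'$.
   Context: A hyperplane arrangement $\mathcal{A}$ is a finite set of linear hyperplanes in a finite-dimensional vector space $V\cong\mathbb{K}^\ell$ over a field $\mathbb{K}$; $\Phi_\ell$ denotes the empty arrangement in an $\ell$-dimensional space. For $H\in\mathcal{A}$ the restriction is $\mathcal{A}^H:=\{H\cap K\mid K\in\mathcal{A}\setminus\{H\}\}$. Freeness: let $S=S(V^* )\cong\mathbb{K}[x_1,\dots,x_\ell]$, let $\mathrm{Der}(S)$ be the $S$-module of $\mathbb{K}$-derivations of $S$ with basis $\partial/\partial x_i$, and for each $H\in\mathcal{A}$ fix $\alpha_H\in V^*$ with $H=\ker\alpha_H$. Put $D(\mathcal{A}):=\{\theta\in\mathrm{Der}(S)\mid\theta(\alpha_H)\in\alpha_H S\text{ for all }H\in\mathcal{A}\}$. $\mathcal{A}$ is free if $D(\mathcal{A})$ is a free $S$-module. In that case it has a homogeneous basis $\theta_1,\dots,\theta_\ell$ ($\theta=\sum f_i\,\partial/\partial x_i$ is homogeneous of polynomial degree $p$ if all $f_i$ are homogeneous of degree $p$ or zero), and $\exp(\mathcal{A})$ is the multiset of polynomial degrees of the $\theta_i$, which depends only on $\mathcal{A}$. The notation $(d_1,\dots,d_\ell)_\le$ means $d_1\le\dots\le d_\ell$. One has $\exp(\Phi_\ell)=(0,\dots,0)$. MAT-free: the class $\mathfrak{MF}$ of MAT-free arrangements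 is the smallest class of arrangements such that (i) $\Phi_\ell$ is in the class for every $\ell\ge0$; (ii) if $\mathcal{A}'$ is in the class with $\exp(\mathcal{A}')=(d_1,\dots,d_\ell)_\le$, $1\le p\le\ell$ is the multiplicity of the highest exponent $d=d_\ell$, and $H_1,\dots,H_q$ with $q\le p$ are hyperplanes not in $\mathcal{A}'$ such that (1) $X:=H_1\cap\dots\cap H_q$ has codimension $q$, (2) $X\not\subseteq\bigcup_{H\in\mathcal{A}'}H$, (3) $|\mathcal{A}'|-|(\mathcal{A}'\cup\{H_j\})^{H_j}|=d$ for $1\le j\le q$, then $\mathcal{A}:=\mathcal{A}'\cup\{H_1,\dots,H_q\}$ is in the class (it is then free with exponents $(d_1,\dots,d_{\ell-q},d+1,\dots,d+1)_\le$). MAT2-free: the class $\mathfrak{MF}'$ of MAT2-free arrangements is the smallest class of arrangements such that (i) $\Phi_\ell$ is in the class for every $\ell\ge0$; (ii) if $\mathcal{A}'$ is in the class with $\exp(\mathcal{A}')=(d_1,\dots,d_\ell)_\le$, and $H_s,\dots,H_\ell$ are hyperplanes not in $\mathcal{A}'$, where $s>\min\{i\mid d_i\ne0\}$ if $\mathcal{A}'\ne\Phi_\ell$ and $s>0$ if $\mathcal{A}'=\Phi_\ell$, such that (1) $X:=H_s\cap\dots\cap H_\ell$ has codimension $\ell-s+1$, (2) $X\not\subseteq\bigcup_{H\in\mathcal{A}'}H$, (3) $|\mathcal{A}'|-|(\mathcal{A}'\cup\{H_j\})^{H_j}|=d_j$ for $s\le j\le\ell$, then $\mathcal{A}:=\mathcal{A}'\cup\{H_s,\dots,H_\ell\}$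 is in the class (it is then free with exponents $(d_1,\dots,d_{s-1},d_s+1,\dots,d_\ell+1)_\le$). *)

theory Defs
  imports
    Complex_Main
    "HOL-Library.Poly_Mapping"
    "HOL-Library.Function_Algebras"
    "HOL-Library.FuncSet"
begin

(* K^l is the space of all v :: nat => 'k with v i = 0 for i >= l; the dimension l is a
   natural number (not a type) because the classes below contain arrangements of every
   dimension l >= 0. *)

type_synonym 'k kvec = "nat \<Rightarrow> 'k"

definition scale_kvec :: "'k::field \<Rightarrow> 'k kvec \<Rightarrow> 'k kvec"
  where "scale_kvec c v = (\<lambda>i. c * v i)"

global_interpretation kvec: vector_space "scale_kvec :: 'k::field \<Rightarrow> 'k kvec \<Rightarrow> 'k kvec"
  by unfold_locales (auto simp: scale_kvec_def fun_eq_iff algebra_simps)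

definition coord_space :: "nat \<Rightarrow> 'k::field kvec set"
  where "coord_space l = {v. \<forall>i\<ge>l. v i = 0}"

definition codim :: "nat \<Rightarrow> 'k::field kvec set \<Rightarrow> nat"
  where "codim l X = kvec.dim (coord_space l :: 'k kvec set) - kvec.dim X"

(* A linear form is given by its coefficient vector a in K^l. *)

definition form_kernel :: "nat \<Rightarrow> 'k::field kvec \<Rightarrow> 'k kvec set"
  where "form_kernel l a = {v \<in> coord_space l. (\<Sum>i<l. a i * v i) = 0}"

definition hyperplane :: "nat \<Rightarrow> 'k::field kvec set \<Rightarrow> bool"
  where "hyperplane l H \<longleftrightarrow> (\<exists>a \<in> coord_space l. a \<noteq> 0 \<and> H = form_kernel l a)"

definition restriction :: "'k kvec set set \<Rightarrow> 'k kvec set \<Rightarrow> 'k kvec set set"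
  where "restriction A H = {H \<inter> K | K. K \<in> A - {H}}"


(* Polynomials in x_0, x_1, ...: finitely supported maps from monomials (exponent vectors)
   to coefficients, with convolution as product.  The symmetric algebra S of the dual of K^l
   is the subring of polynomials involving only x_0, ..., x_(l-1). *)

type_synonym 'k mpoly = "(nat \<Rightarrow>\<^sub>0 nat) \<Rightarrow>\<^sub>0 'k"

definition poly_ring :: "nat \<Rightarrow> 'k::field mpoly set"
  where "poly_ring l = {f. \<forall>m \<in> Poly_Mapping.keys f. Poly_Mapping.keys m \<subseteq> {..<l}}"

definition poly_const :: "'k::field \<Rightarrow> 'k mpoly"
  where "poly_const c = Poly_Mapping.single 0 c"

definition poly_var :: "nat \<Rightarrow> 'k::field mpoly"
  where "poly_var i = Poly_Mapping.single (Poly_Mapping.single i 1) 1"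

definition linear_form :: "nat \<Rightarrow> 'k::field kvec \<Rightarrow> 'k mpoly"
  where "linear_form l a = (\<Sum>i<l. poly_const (a i) * poly_var i)"

definition monomial_degree :: "(nat \<Rightarrow>\<^sub>0 nat) \<Rightarrow> nat"
  where "monomial_degree m = (\<Sum>i \<in> Poly_Mapping.keys m. Poly_Mapping.lookup m i)"

(* The zero polynomial is homogeneous of every degree. *)

definition homogeneous :: "nat \<Rightarrow> 'k::field mpoly \<Rightarrow> bool"
  where "homogeneous p f \<longleftrightarrow> (\<forall>m \<in> Poly_Mapping.keys f. monomial_degree m = p)"


(* K-derivations of S; a map on S is represented by its extension by 0 outside S. *)

definition Der :: "nat \<Rightarrow> ('k::field mpoly \<Rightarrow> 'k mpoly) set"
  where "Der l = {\<theta>.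
    (\<forall>f \<in> poly_ring l. \<theta> f \<in> poly_ring l) \<and> (\<forall>f. f \<notin> poly_ring l \<longrightarrow> \<theta> f = 0) \<and>
    (\<forall>f \<in> poly_ring l. \<forall>g \<in> poly_ring l. \<theta> (f + g) = \<theta> f + \<theta> g) \<and>
    (\<forall>c. \<forall>f \<in> poly_ring l. \<theta> (poly_const c * f) = poly_const c * \<theta> f) \<and>
    (\<forall>f \<in> poly_ring l. \<forall>g \<in> poly_ring l. \<theta> (f * g) = f * \<theta> g + \<theta> f * g)}"

(* For theta = sum_i f_i d/dx_i the coefficient f_i is theta(x_i). *)

definition homogeneous_der :: "nat \<Rightarrow> nat \<Rightarrow> ('k::field mpoly \<Rightarrow> 'k mpoly) \<Rightarrow> bool"
  where "homogeneous_der l p \<theta> \<longleftrightarrow> (\<forall>i<l. homogeneous p (\<theta> (poly_var i)))"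

(* The condition does not depend on which form alpha_H with kernel H is chosen (they are
   nonzero multiples of each other), so it is imposed for all of them. *)

definition log_der :: "nat \<Rightarrow> 'k::field kvec set set \<Rightarrow> ('k mpoly \<Rightarrow> 'k mpoly) set"
  where "log_der l A = {\<theta> \<in> Der l. \<forall>H \<in> A. \<forall>a \<in> coord_space l. H = form_kernel l a \<longrightarrow>
    (\<exists>g \<in> poly_ring l. \<theta> (linear_form l a) = linear_form l a * g)}"

definition log_der_basis ::
  "nat \<Rightarrow> 'k::field kvec set set \<Rightarrow> (nat \<Rightarrow> 'k mpoly \<Rightarrow> 'k mpoly) \<Rightarrow> bool"
  where "log_der_basis l A \<theta> \<longleftrightarrow>
    (\<forall>i \<in> {1..l}. \<theta> i \<in> log_der l A) \<and>
    (\<forall>\<eta> \<in> log_der l A. \<exists>!g. g \<in> {1..l} \<rightarrow>\<^sub>E poly_ring l \<and> \<eta> = (\<lambda>f. \<Sum>i=1..l. g i * \<theta> i f))"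

(* exponents l A d: A is free with exp(A) = (d 1, ..., d l), d 1 <= ... <= d l.  Since the
   multiset exp(A) depends only on A, the values of d on {1..l} are determined by A. *)

definition exponents :: "nat \<Rightarrow> 'k::field kvec set set \<Rightarrow> (nat \<Rightarrow> nat) \<Rightarrow> bool"
  where "exponents l A d \<longleftrightarrow> mono_on {1..l} d \<and>
    (\<exists>\<theta>. log_der_basis l A \<theta> \<and> (\<forall>i \<in> {1..l}. homogeneous_der l (d i) (\<theta> i)))"


(* An arrangement is recorded together with the dimension of its ambient space;
   (l, {}) is the empty arrangement Phi_l. *)

inductive_set MAT_free :: "(nat \<times> 'k::field kvec set set) set" where
  empty: "(l, {}) \<in> MAT_free"
| step: "(l, A' \<union> H ` {1..q}) \<in> MAT_free"
  if "(l, A') \<in> MAT_free"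
    and "exponents l A' d"
    and "p = card {i \<in> {1..l}. d i = d l}" and "1 \<le> p" and "p \<le> l"
    and "1 \<le> q" and "q \<le> p"
    and "\<forall>j \<in> {1..q}. hyperplane l (H j) \<and> H j \<notin> A'"
    and "X = (\<Inter>j \<in> {1..q}. H j)"
    and "codim l X = q"
    and "\<not> X \<subseteq> \<Union>A'"
    and "\<forall>j \<in> {1..q}.
      int (card A') - int (card (restriction (A' \<union> {H j}) (H j))) = int (d l)"

inductive_set MAT2_free :: "(nat \<times> 'k::field kvec set set) set" where
  empty: "(l, {}) \<in> MAT2_free"
| step: "(l, A' \<union> H ` {s..l}) \<in> MAT2_free"
  if "(l, A') \<in> MAT2_free"
    and "exponents l A' d"
    and "s \<le> l"
    and "A' \<noteq> {} \<longrightarrow> s > Min {i \<in> {1..l}. d i \<noteq> 0}"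
    and "A' = {} \<longrightarrow> s > 0"
    and "\<forall>j \<in> {s..l}. hyperplane l (H j) \<and> H j \<notin> A'"
    and "X = (\<Inter>j \<in> {s..l}. H j)"
    and "codim l X = l - s + 1"
    and "\<not> X \<subseteq> \<Union>A'"
    and "\<forall>j \<in> {s..l}.
      int (card A') - int (card (restriction (A' \<union> {H j}) (H j))) = int (d j)"

end

(* For the inclusion, put s = l - q + 1; only the condition s > min {i | d_i <> 0} needs an argument.
   If it failed, the first l - q exponents would vanish, so the centre of A' would have codimension
   at most q.  Condition (3) forces every H_j to contain the centre, hence X is the centre, which
   contradicts condition (2).

   For strictness, consider in dimension three the members x + c y = 0 of a pencil, c = 0, ..., 6,
   together with the transversals z = t x + t^2 y, t = 0, 1, 2, 4.  The transversals s and t meet on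
   the member s + t, and the six sums are distinct.  Adding each new transversal together with a
   fresh member of the pencil is a MAT2 step.  In a final MAT step only c = 0 can be removed, and
   afterwards no MAT step is possible at all. *)

theory Submission
  imports Defs "HOL-Computational_Algebra.Polynomial"
begin

section \<open>Polynomials as finitely supported maps\<close>

text \<open>Both classes refer to exponents of the module of derivations itself. A MAT2 step
  therefore needs an explicit homogeneous basis. For a pencil \<open>C\<close> containing all sums
  from \<open>T\<close> and a spare member, it consists of the Euler derivation, a vertical one of
  degree |T| and an interpolated one of degree |C| - 1. Excluding MAT steps is harder: the smaller
  arrangement is free by hypothesis only, with no basis at hand. Hence only inequalities are proved:
  d1 >= 1, d2 >= min(|C| - 1, |T|), d3 >= |C| - 1, and a sum of at most the number of planes.
  Removing a member s + t merges two traces on it, so that condition (3) asks for a d3 that is one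
  too large for this sum. The slopes (t, t^2) turn intersections into addition, because (s, s^2) -
  (t, t^2) is proportional to (1, s + t). The set {0, 1, 2, 4} has the six sums 1, ..., 6. There are
  two more sums than transversals, which rules out the removal of a transversal, and 0 is not a sum,
  which provides the spare member.\<close>

definition monomial_value :: "(nat \<Rightarrow> 'a::comm_ring_1) \<Rightarrow> (nat \<Rightarrow>\<^sub>0 nat) \<Rightarrow> 'a"
  where "monomial_value s m = (\<Prod>i\<in>Poly_Mapping.keys m. s i ^ Poly_Mapping.lookup m i)"

definition mpoly_eval :: "('k::field \<Rightarrow> 'a::comm_ring_1) \<Rightarrow> (nat \<Rightarrow> 'a) \<Rightarrow> 'k mpoly \<Rightarrow> 'a"
  where "mpoly_eval c s f =
    (\<Sum>m\<in>Poly_Mapping.keys f. c (Poly_Mapping.lookup f m) * monomial_value s m)"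

lemma monomial_value_superset:
  assumes "finite A" "Poly_Mapping.keys m \<subseteq> A"
  shows "monomial_value s m = (\<Prod>i\<in>A. s i ^ Poly_Mapping.lookup m i)"
  unfolding monomial_value_def
  by (rule prod.mono_neutral_left) (use assms in \<open>auto simp: in_keys_iff\<close>)

lemma monomial_value_add: "monomial_value s (m + n) = monomial_value s m * monomial_value s n"
proof -
  let ?A = "Poly_Mapping.keys m \<union> Poly_Mapping.keys n"
  have "Poly_Mapping.keys (m + n) \<subseteq> ?A" by (rule keys_add)
  then show ?thesis
    by (simp add: monomial_value_superset[of ?A] lookup_add power_add prod.distrib)
qed

lemma monomial_value_zero [simp]: "monomial_value s 0 = 1"
  by (simp add: monomial_value_def)

lemma monomial_value_single [simp]: "monomial_value s (Poly_Mapping.single i n) = s i ^ n"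
  by (simp add: monomial_value_def)

lemma sum_single_lookup:
  "(\<Sum>m\<in>Poly_Mapping.keys f. Poly_Mapping.single m (Poly_Mapping.lookup f m)) = f"
proof (rule poly_mapping_eqI)
  fix k
  show "Poly_Mapping.lookup (\<Sum>m\<in>Poly_Mapping.keys f.
      Poly_Mapping.single m (Poly_Mapping.lookup f m)) k = Poly_Mapping.lookup f k"
    by (simp add: lookup_sum lookup_single when_def in_keys_iff)
qed

text \<open>One evaluation map serves three purposes, according to the coefficient map
  \<open>c\<close>: substitution of polynomials for variables, evaluation at a point, and
  substitution into polynomials in a further variable t, whose t-coefficient gives
  derivations.\<close>

locale coeff_hom =
  fixes c :: "'k::field \<Rightarrow> 'a::comm_ring_1"
  assumes hom_add: "c (a + b) = c a + c b"
    and hom_mult: "c (a * b) = c a * c b"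
    and hom_one [simp]: "c 1 = 1"
begin

lemma hom_zero [simp]: "c 0 = 0"
  using hom_add[of 0 0] by simp

lemma hom_uminus [simp]: "c (- a) = - c a"
  using hom_add[of a "- a"] by (simp add: eq_neg_iff_add_eq_0 add.commute)

lemma eval_superset:
  assumes "finite A" "Poly_Mapping.keys f \<subseteq> A"
  shows "mpoly_eval c s f = (\<Sum>m\<in>A. c (Poly_Mapping.lookup f m) * monomial_value s m)"
  unfolding mpoly_eval_def
  by (rule sum.mono_neutral_left) (use assms in \<open>auto simp: in_keys_iff\<close>)

lemma eval_add [simp]: "mpoly_eval c s (f + g) = mpoly_eval c s f + mpoly_eval c s g"
proof -
  let ?A = "Poly_Mapping.keys f \<union> Poly_Mapping.keys g"
  have "Poly_Mapping.keys (f + g) \<subseteq> ?A" by (rule keys_add)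
  then show ?thesis
    by (simp add: eval_superset[of ?A] lookup_add hom_add distrib_right sum.distrib)
qed

lemma eval_single [simp]: "mpoly_eval c s (Poly_Mapping.single m a) = c a * monomial_value s m"
  by (cases "a = 0") (simp_all add: mpoly_eval_def)

lemma eval_zero [simp]: "mpoly_eval c s 0 = 0"
  by (simp add: mpoly_eval_def)

lemma eval_sum [simp]: "mpoly_eval c s (\<Sum>i\<in>I. f i) = (\<Sum>i\<in>I. mpoly_eval c s (f i))"
  by (induction I rule: infinite_finite_induct) auto

lemma eval_mult [simp]: "mpoly_eval c s (f * g) = mpoly_eval c s f * mpoly_eval c s g"
proof -
  have "f * g = (\<Sum>m\<in>Poly_Mapping.keys f. \<Sum>n\<in>Poly_Mapping.keys g.
      Poly_Mapping.single (m + n) (Poly_Mapping.lookup f m * Poly_Mapping.lookup g n))"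
    (is "_ = ?R")
  proof -
    have "f * g = (\<Sum>m\<in>Poly_Mapping.keys f. Poly_Mapping.single m (Poly_Mapping.lookup f m))
        * (\<Sum>n\<in>Poly_Mapping.keys g. Poly_Mapping.single n (Poly_Mapping.lookup g n))"
      by (simp only: sum_single_lookup)
    also have "\<dots> = ?R" by (simp only: sum_product mult_single)
    finally show ?thesis .
  qed
  then have "mpoly_eval c s (f * g) = (\<Sum>m\<in>Poly_Mapping.keys f. \<Sum>n\<in>Poly_Mapping.keys g.
      (c (Poly_Mapping.lookup f m) * monomial_value s m)
        * (c (Poly_Mapping.lookup g n) * monomial_value s n))"
    by (simp add: monomial_value_add hom_mult mult_ac)
  also have "\<dots> = mpoly_eval c s f * mpoly_eval c s g"
    by (simp add: mpoly_eval_def sum_product)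
  finally show ?thesis .
qed

lemma eval_one [simp]: "mpoly_eval c s 1 = 1"
  using eval_single[of s 0 1] by simp

lemma eval_uminus [simp]: "mpoly_eval c s (- f) = - mpoly_eval c s f"
proof -
  have "mpoly_eval c s (- f) + mpoly_eval c s f = 0" by (simp flip: eval_add)
  then show ?thesis by (simp add: eq_neg_iff_add_eq_0)
qed

lemma eval_diff [simp]: "mpoly_eval c s (f - g) = mpoly_eval c s f - mpoly_eval c s g"
  using eval_add[of s f "- g"] by simp

lemma eval_prod [simp]: "mpoly_eval c s (\<Prod>i\<in>I. f i) = (\<Prod>i\<in>I. mpoly_eval c s (f i))"
  by (induction I rule: infinite_finite_induct) auto

lemma eval_power [simp]: "mpoly_eval c s (f ^ n) = mpoly_eval c s f ^ n"
  by (induction n) auto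

lemma eval_const [simp]: "mpoly_eval c s (poly_const a) = c a"
  by (simp add: poly_const_def)

lemma eval_var [simp]: "mpoly_eval c s (poly_var i) = s i"
  by (simp add: poly_var_def)

end

lemma poly_const_add: "poly_const (a + b) = poly_const a + poly_const b"
  by (simp add: poly_const_def single_add)

lemma poly_const_mult: "poly_const (a * b) = poly_const a * poly_const b"
  by (simp add: poly_const_def mult_single)

lemma poly_const_1 [simp]: "poly_const 1 = 1"
  by (simp add: poly_const_def)

interpretation subst: coeff_hom "poly_const :: 'k::field \<Rightarrow> 'k mpoly"
  by unfold_locales (simp_all add: poly_const_add poly_const_mult)

interpretation point: coeff_hom "id :: 'k::field \<Rightarrow> 'k"
  by unfold_locales simp_all

interpretation dual: coeff_hom "\<lambda>a::'k::field. [:poly_const a:]"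
  by unfold_locales (simp_all add: poly_const_add poly_const_mult)

lemma poly_const_diff: "poly_const (a - b) = poly_const a - poly_const b"
  using poly_const_add[of a "- b"] by simp

lemma poly_const_eq_0_iff [simp]: "poly_const a = 0 \<longleftrightarrow> a = 0"
proof
  assume "poly_const a = 0"
  then have "mpoly_eval id (\<lambda>i. 0) (poly_const a) = mpoly_eval id (\<lambda>i. 0) (0 :: 'a mpoly)"
    by simp
  then show "a = 0" by simp
qed simp

lemma poly_const_prod: "poly_const (\<Prod>i\<in>I. f i) = (\<Prod>i\<in>I. poly_const (f i))"
  by (induction I rule: infinite_finite_induct) (auto simp: poly_const_mult)

text \<open>Presents a polynomial as an expression built from constants and variables by sums and
  products. The induction rule for the ring works along this expression.\<close>

lemma eval_variables [simp]: "mpoly_eval poly_const poly_var f = f"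
proof -
  have mono: "monomial_value poly_var m = Poly_Mapping.single m (1::'k::field)" for m
  proof -
    have pow: "poly_var i ^ n = Poly_Mapping.single (Poly_Mapping.single i n) (1::'k)" for i n
      by (induction n) (simp_all add: poly_var_def mult_single single_add[symmetric])
    have "finite A \<Longrightarrow> (\<Prod>i\<in>A. poly_var i ^ Poly_Mapping.lookup m i) =
        Poly_Mapping.single (\<Sum>i\<in>A. Poly_Mapping.single i (Poly_Mapping.lookup m i)) (1::'k)" for A
      by (induction A rule: finite_induct) (simp_all add: pow mult_single)
    then show ?thesis by (simp add: monomial_value_def sum_single_lookup)
  qed
  show ?thesis
    unfolding mpoly_eval_def mono poly_const_def
    by (simp add: mult_single sum_single_lookup)
qed

section \<open>The subring of polynomials in the first \<open>l\<close> variables\<close>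

lemma poly_ring_zero [simp]: "0 \<in> poly_ring l"
  by (simp add: poly_ring_def)

lemma poly_ring_const [simp]: "poly_const a \<in> poly_ring l"
  by (cases "a = 0") (simp_all add: poly_ring_def poly_const_def)

lemma poly_ring_one [simp]: "1 \<in> poly_ring l"
  using poly_ring_const[of 1] by simp

lemma poly_ring_var [simp]: "poly_var i \<in> poly_ring l \<longleftrightarrow> i < l"
  by (simp add: poly_ring_def poly_var_def)

lemma poly_ring_add [simp]: "f \<in> poly_ring l \<Longrightarrow> g \<in> poly_ring l \<Longrightarrow> f + g \<in> poly_ring l"
  using keys_add[of f g] by (fastforce simp: poly_ring_def)

lemma poly_ring_mult [simp]:
  assumes "f \<in> poly_ring l" "g \<in> poly_ring l"
  shows "f * g \<in> poly_ring l"
  unfolding poly_ring_def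
proof (intro CollectI ballI)
  fix m assume "m \<in> Poly_Mapping.keys (f * g)"
  then obtain a b where "m = a + b" "a \<in> Poly_Mapping.keys f" "b \<in> Poly_Mapping.keys g"
    using keys_mult[of f g] by blast
  then show "Poly_Mapping.keys m \<subseteq> {..<l}"
    using assms keys_add[of a b] by (fastforce simp: poly_ring_def)
qed

lemma poly_ring_uminus [simp]: "f \<in> poly_ring l \<Longrightarrow> - f \<in> poly_ring l"
  using poly_ring_mult[of "poly_const (- 1)" l f] poly_ring_const[of "- 1" l]
  by (simp del: poly_ring_const)

lemma poly_ring_diff [simp]: "f \<in> poly_ring l \<Longrightarrow> g \<in> poly_ring l \<Longrightarrow> f - g \<in> poly_ring l"
  using poly_ring_add[of f l "- g"] by simp

lemma poly_ring_sum [simp]: "(\<And>i. i \<in> I \<Longrightarrow> f i \<in> poly_ring l) \<Longrightarrow> (\<Sum>i\<in>I. f i) \<in> poly_ring l"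
  by (induction I rule: infinite_finite_induct) auto

lemma poly_ring_prod [simp]: "(\<And>i. i \<in> I \<Longrightarrow> f i \<in> poly_ring l) \<Longrightarrow> (\<Prod>i\<in>I. f i) \<in> poly_ring l"
  by (induction I rule: infinite_finite_induct) auto

lemma poly_ring_power [simp]: "f \<in> poly_ring l \<Longrightarrow> f ^ n \<in> poly_ring l"
  by (induction n) auto

lemma poly_ring_induct [consumes 1, case_names const var add mult]:
  assumes f: "f \<in> poly_ring l"
    and const: "\<And>a. P (poly_const a)"
    and var: "\<And>i. i < l \<Longrightarrow> P (poly_var i)"
    and add: "\<And>f g. f \<in> poly_ring l \<Longrightarrow> g \<in> poly_ring l \<Longrightarrow> P f \<Longrightarrow> P g \<Longrightarrow> P (f + g)"
    and mult: "\<And>f g. f \<in> poly_ring l \<Longrightarrow> g \<in> poly_ring l \<Longrightarrow> P f \<Longrightarrow> P g \<Longrightarrow> P (f * g)"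
  shows "P f"
proof -
  \<comment> \<open>Membership is carried along because \<open>add\<close> and \<open>mult\<close>
    apply to elements of the ring only. \<open>Q\<close> is then closed under everything occurring
    in \<open>mpoly_eval poly_const poly_var f\<close>, which is \<open>f\<close>.\<close>
  define Q where "Q g \<longleftrightarrow> g \<in> poly_ring l \<and> P g" for g
  have Q0: "Q 0" using const[of 0] by (simp add: Q_def)
  have Q1: "Q 1" using const[of 1] by (simp add: Q_def)
  have Qadd: "Q (g + h)" and Qmult: "Q (g * h)" if "Q g" "Q h" for g h
    using that add mult by (auto simp: Q_def)
  have Qpow: "Q (g ^ n)" if "Q g" for g n
    by (induction n) (use that Q1 Qmult in auto)
  have Qsum: "Q (\<Sum>i\<in>I. h i)" if "\<And>i. i \<in> I \<Longrightarrow> Q (h i)" for I and h :: "(nat \<Rightarrow>\<^sub>0 nat) \<Rightarrow> _"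
    using that by (induction I rule: infinite_finite_induct) (auto intro: Q0 Qadd)
  have Qprod: "Q (\<Prod>i\<in>I. h i)" if "\<And>i. i \<in> I \<Longrightarrow> Q (h i)" for I and h :: "nat \<Rightarrow> _"
    using that by (induction I rule: infinite_finite_induct) (auto intro: Q1 Qmult)
  have Qconst: "Q (poly_const a)" for a using const by (simp add: Q_def)
  have Qvar: "Q (poly_var i)" if "m \<in> Poly_Mapping.keys f" "i \<in> Poly_Mapping.keys m" for m i
  proof -
    have "i < l" using f that by (auto simp: poly_ring_def)
    then show ?thesis using var by (simp add: Q_def)
  qed
  have "Q (mpoly_eval poly_const poly_var f)"
    unfolding mpoly_eval_def monomial_value_def
    by (intro Qsum Qmult Qprod Qpow Qconst Qvar)
  then show ?thesis by (simp add: Q_def)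
qed

text \<open>The retraction killing the variables outside the ring shows that exact quotients stay in
  the ring.\<close>

lemma poly_ring_cofactor:
  assumes "a * q \<in> poly_ring l" "a \<in> poly_ring l" "a \<noteq> 0"
  shows "q \<in> poly_ring l"
proof -
  define r where "r = mpoly_eval poly_const (\<lambda>i. if i < l then poly_var i else 0 :: 'a mpoly)"
  have r_in: "r f \<in> poly_ring l" for f
    unfolding r_def mpoly_eval_def monomial_value_def
    by (intro poly_ring_sum poly_ring_mult poly_ring_prod poly_ring_power) auto
  have r_id: "r f = f" if "f \<in> poly_ring l" for f
    using that by (induction rule: poly_ring_induct) (simp_all add: r_def)
  have "a * q = r (a * q)" using r_id assms(1) by simp
  also have "\<dots> = a * r q" using r_id[OF assms(2)] by (simp add: r_def)
  finally have "q = r q" using assms(3) by simp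
  then show ?thesis using r_in by metis
qed

lemma linear_form_in_poly_ring [simp]: "linear_form l a \<in> poly_ring l"
  unfolding linear_form_def by (intro poly_ring_sum poly_ring_mult) auto

lemma linear_form_eq_0_iff: "linear_form l a = 0 \<longleftrightarrow> (\<forall>i<l. a i = 0)"
proof
  assume eq: "linear_form l a = 0"
  show "\<forall>i<l. a i = 0"
  proof (intro allI impI)
    fix j assume "j < l"
    have "mpoly_eval id (\<lambda>i. if i = j then 1 else 0) (linear_form l a) = 0"
      using eq by simp
    then show "a j = 0" using \<open>j < l\<close> by (simp add: linear_form_def if_distrib cong: if_cong)
  qed
qed (simp add: linear_form_def)

section \<open>Degrees and homogeneity\<close>

lemma monomial_degree_superset:
  assumes "finite A" "Poly_Mapping.keys m \<subseteq> A"
  shows "monomial_degree m = (\<Sum>i\<in>A. Poly_Mapping.lookup m i)"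
  unfolding monomial_degree_def
  by (rule sum.mono_neutral_left) (use assms in \<open>auto simp: in_keys_iff\<close>)

lemma monomial_degree_add: "monomial_degree (m + n) = monomial_degree m + monomial_degree n"
proof -
  let ?A = "Poly_Mapping.keys m \<union> Poly_Mapping.keys n"
  have "Poly_Mapping.keys (m + n) \<subseteq> ?A" by (rule keys_add)
  then show ?thesis
    by (simp add: monomial_degree_superset[of ?A] lookup_add sum.distrib)
qed

lemma homogeneous_zero [simp]: "homogeneous n 0"
  by (simp add: homogeneous_def)

lemma homogeneous_const [simp]: "homogeneous 0 (poly_const a)"
  by (cases "a = 0") (simp_all add: homogeneous_def poly_const_def monomial_degree_def)

lemma homogeneous_var [simp]: "homogeneous (Suc 0) (poly_var i)"
  by (simp add: homogeneous_def poly_var_def monomial_degree_def)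

lemma homogeneous_add [simp]: "homogeneous n f \<Longrightarrow> homogeneous n g \<Longrightarrow> homogeneous n (f + g)"
  using keys_add[of f g] by (auto simp: homogeneous_def)

lemma homogeneous_mult:
  "homogeneous m f \<Longrightarrow> homogeneous n g \<Longrightarrow> k = m + n \<Longrightarrow> homogeneous k (f * g)"
  using keys_mult[of f g] by (fastforce simp: homogeneous_def monomial_degree_add)

lemma homogeneous_const_mult [simp]: "homogeneous n f \<Longrightarrow> homogeneous n (poly_const a * f)"
  by (rule homogeneous_mult[of 0 _ n]) auto

lemma homogeneous_uminus [simp]: "homogeneous n f \<Longrightarrow> homogeneous n (- f)"
  using homogeneous_const_mult[of n f "- 1"] by simp

lemma homogeneous_diff [simp]: "homogeneous n f \<Longrightarrow> homogeneous n g \<Longrightarrow> homogeneous n (f - g)"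
  using homogeneous_add[of n f "- g"] by simp

lemma homogeneous_sum: "(\<And>i. i \<in> I \<Longrightarrow> homogeneous n (f i)) \<Longrightarrow> homogeneous n (\<Sum>i\<in>I. f i)"
  by (induction I rule: infinite_finite_induct) auto

lemma homogeneous_prod_linear:
  assumes "\<And>i. i \<in> I \<Longrightarrow> homogeneous 1 (f i)" "n = card I"
  shows "homogeneous n (\<Prod>i\<in>I. f i)"
  using assms homogeneous_const[of 1]
  by (induction I arbitrary: n rule: infinite_finite_induct) (auto intro: homogeneous_mult[of "Suc 0"])

text \<open>The order of vanishing at the origin. Unlike homogeneity, a lower bound for it passes to
  arbitrary multiples, so nothing has to be known about cofactors.\<close>

definition order_at_least :: "nat \<Rightarrow> 'k::field mpoly \<Rightarrow> bool"
  where "order_at_least n f \<longleftrightarrow> (\<forall>m\<in>Poly_Mapping.keys f. n \<le> monomial_degree m)"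

lemma order_at_least_homogeneous: "homogeneous n f \<Longrightarrow> order_at_least n f"
  by (auto simp: homogeneous_def order_at_least_def)

lemma order_at_least_mult: "order_at_least n f \<Longrightarrow> order_at_least n (f * g)"
  using keys_mult[of f g] by (fastforce simp: order_at_least_def monomial_degree_add)

text \<open>A multiple of \<open>g\<close> has no monomials of degree below \<open>k\<close>. All
  later degree estimates for derivations and determinants rest on this.\<close>

lemma homogeneous_eq_zero:
  assumes "homogeneous n f" "homogeneous k g" "g dvd f" "n < k"
  shows "f = 0"
proof -
  from assms(3) obtain h where "f = g * h" by (elim dvdE)
  then have "order_at_least k f"
    using assms(2) order_at_least_mult order_at_least_homogeneous by blast
  with assms(1,4) have "Poly_Mapping.keys f = {}"
    by (force simp: homogeneous_def order_at_least_def)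
  then show ?thesis by simp
qed

lemma homogeneous_0_imp_const: "homogeneous 0 f \<Longrightarrow> f = poly_const (Poly_Mapping.lookup f 0)"
proof (rule poly_mapping_eqI)
  fix m assume hom: "homogeneous 0 f"
  have "m = 0" if "m \<in> Poly_Mapping.keys f"
  proof -
    have "\<forall>i\<in>Poly_Mapping.keys m. Poly_Mapping.lookup m i = 0"
      using hom that by (simp add: homogeneous_def monomial_degree_def)
    then show ?thesis by (intro poly_mapping_eqI) (auto simp: in_keys_iff)
  qed
  then show "Poly_Mapping.lookup f m = Poly_Mapping.lookup (poly_const (Poly_Mapping.lookup f 0)) m"
    by (cases "m \<in> Poly_Mapping.keys f") (auto simp: poly_const_def lookup_single when_def in_keys_iff)
qed

section \<open>Derivations\<close>

lemma Der_add: "\<theta> \<in> Der l \<Longrightarrow> f \<in> poly_ring l \<Longrightarrow> g \<in> poly_ring l \<Longrightarrow> \<theta> (f + g) = \<theta> f + \<theta> g"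
  and Der_mult: "\<theta> \<in> Der l \<Longrightarrow> f \<in> poly_ring l \<Longrightarrow> g \<in> poly_ring l \<Longrightarrow> \<theta> (f * g) = f * \<theta> g + \<theta> f * g"
  and Der_scale: "\<theta> \<in> Der l \<Longrightarrow> f \<in> poly_ring l \<Longrightarrow> \<theta> (poly_const a * f) = poly_const a * \<theta> f"
  and Der_in: "\<theta> \<in> Der l \<Longrightarrow> f \<in> poly_ring l \<Longrightarrow> \<theta> f \<in> poly_ring l"
  and Der_outside: "\<theta> \<in> Der l \<Longrightarrow> f \<notin> poly_ring l \<Longrightarrow> \<theta> f = 0"
  unfolding Der_def by blast+

lemma Der_const:
  assumes "\<theta> \<in> Der l"
  shows "\<theta> (poly_const a) = 0"
proof -
  have "\<theta> 1 = \<theta> 1 + \<theta> 1" using Der_mult[OF assms, of 1 1] by (simp only: poly_ring_one mult_1 mult_1_right)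
  then have "\<theta> 1 = 0" by (metis add_cancel_right_right)
  then show ?thesis using Der_scale[OF assms, of 1 a] by simp
qed

lemma Der_sum:
  assumes "\<theta> \<in> Der l" "\<And>i. i \<in> I \<Longrightarrow> f i \<in> poly_ring l"
  shows "\<theta> (\<Sum>i\<in>I. f i) = (\<Sum>i\<in>I. \<theta> (f i))"
proof -
  have "\<theta> 0 = 0" using Der_const[OF assms(1), of 0] by simp
  then show ?thesis
    using assms(2)
    by (induction I rule: infinite_finite_induct) (simp_all add: Der_add[OF assms(1)])
qed

lemma Der_linear_form:
  assumes "\<theta> \<in> Der l"
  shows "\<theta> (linear_form l a) = (\<Sum>i<l. poly_const (a i) * \<theta> (poly_var i))"
proof -
  have "\<theta> (linear_form l a) = (\<Sum>i<l. \<theta> (poly_const (a i) * poly_var i))"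
    unfolding linear_form_def by (rule Der_sum[OF assms]) simp
  also have "\<dots> = (\<Sum>i<l. poly_const (a i) * \<theta> (poly_var i))"
    by (intro sum.cong refl Der_scale[OF assms]) simp
  finally show ?thesis .
qed

lemma Der_eqI:
  assumes "\<theta> \<in> Der l" "\<eta> \<in> Der l" "\<And>i. i < l \<Longrightarrow> \<theta> (poly_var i) = \<eta> (poly_var i)"
  shows "\<theta> = \<eta>"
proof
  fix f
  show "\<theta> f = \<eta> f"
  proof (cases "f \<in> poly_ring l")
    case True
    then show ?thesis
      by (induction rule: poly_ring_induct)
        (simp_all add: Der_const[OF assms(1)] Der_const[OF assms(2)] assms(3)
          Der_add[OF assms(1)] Der_add[OF assms(2)] Der_mult[OF assms(1)] Der_mult[OF assms(2)])
  qed (simp add: Der_outside[OF assms(1)] Der_outside[OF assms(2)])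
qed

lemma Der_combination:
  assumes "\<And>i. i \<in> I \<Longrightarrow> g i \<in> poly_ring l" "\<And>i. i \<in> I \<Longrightarrow> \<theta> i \<in> Der l"
  shows "(\<lambda>f. \<Sum>i\<in>I. g i * \<theta> i f) \<in> Der l"
  unfolding Der_def
proof (intro CollectI conjI allI impI ballI)
  show "(\<Sum>i\<in>I. g i * \<theta> i f) \<in> poly_ring l" if "f \<in> poly_ring l" for f
    by (intro poly_ring_sum poly_ring_mult) (use assms that in \<open>auto intro: Der_in\<close>)
  show "(\<Sum>i\<in>I. g i * \<theta> i f) = 0" if "f \<notin> poly_ring l" for f
    using that by (simp add: Der_outside[OF assms(2)])
  show "(\<Sum>i\<in>I. g i * \<theta> i (f + h)) = (\<Sum>i\<in>I. g i * \<theta> i f) + (\<Sum>i\<in>I. g i * \<theta> i h)"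
    if "f \<in> poly_ring l" "h \<in> poly_ring l" for f h
    unfolding sum.distrib[symmetric]
    by (intro sum.cong refl) (simp add: Der_add[OF assms(2)] that algebra_simps)
  show "(\<Sum>i\<in>I. g i * \<theta> i (poly_const c * f)) = poly_const c * (\<Sum>i\<in>I. g i * \<theta> i f)"
    if "f \<in> poly_ring l" for c f
    unfolding sum_distrib_left
    by (intro sum.cong refl) (simp add: Der_scale[OF assms(2)] that mult.left_commute)
  show "(\<Sum>i\<in>I. g i * \<theta> i (f * h)) = f * (\<Sum>i\<in>I. g i * \<theta> i h) + (\<Sum>i\<in>I. g i * \<theta> i f) * h"
    if "f \<in> poly_ring l" "h \<in> poly_ring l" for f h
    unfolding sum_distrib_left sum_distrib_right sum.distrib[symmetric]
    by (intro sum.cong refl) (simp add: Der_mult[OF assms(2)] that algebra_simps)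
qed

text \<open>The substitution \<open>x\<^sub>i \<mapsto> x\<^sub>i + F\<^sub>i t\<close> is multiplicative, so its \<open>t\<close>-coefficient satisfies the
  Leibniz rule.\<close>

definition derivation :: "nat \<Rightarrow> (nat \<Rightarrow> 'k::field mpoly) \<Rightarrow> 'k mpoly \<Rightarrow> 'k mpoly"
  where "derivation l F f = (if f \<in> poly_ring l
    then poly.coeff (mpoly_eval (\<lambda>a. [:poly_const a:]) (\<lambda>i. [:poly_var i, F i:]) f) 1 else 0)"

lemma coeff_0_dual:
  assumes "f \<in> poly_ring l"
  shows "poly.coeff (mpoly_eval (\<lambda>a. [:poly_const a:]) (\<lambda>i. [:poly_var i, F i:]) f) 0 = f"
  using assms by (induction rule: poly_ring_induct) (simp_all add: coeff_mult)

lemma coeff_1_mult: "poly.coeff (p * q) 1 =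
    poly.coeff p 0 * poly.coeff q 1 + poly.coeff p 1 * poly.coeff q (0::nat)"
  for p q :: "'a::comm_ring_1 poly"
  by (simp add: coeff_mult)

lemma derivation_var [simp]: "i < l \<Longrightarrow> derivation l F (poly_var i) = F i"
  by (simp add: derivation_def)

lemma derivation_mult:
  assumes "f \<in> poly_ring l" "g \<in> poly_ring l"
  shows "derivation l F (f * g) = f * derivation l F g + derivation l F f * g"
  using assms by (simp add: derivation_def coeff_0_dual coeff_1_mult del: One_nat_def)

lemma derivation_add:
  "f \<in> poly_ring l \<Longrightarrow> g \<in> poly_ring l \<Longrightarrow> derivation l F (f + g) = derivation l F f + derivation l F g"
  by (simp add: derivation_def)

lemma derivation_const: "derivation l F (poly_const a) = 0"
  by (simp add: derivation_def)

lemma derivation_in_Der [simp]: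
  assumes "\<And>i. i < l \<Longrightarrow> F i \<in> poly_ring l"
  shows "derivation l F \<in> Der l"
proof -
  have "derivation l F f \<in> poly_ring l" if "f \<in> poly_ring l" for f
    using that
    by (induction rule: poly_ring_induct)
      (simp_all add: derivation_const assms derivation_add derivation_mult)
  moreover have "derivation l F (poly_const c * f) = poly_const c * derivation l F f"
    if "f \<in> poly_ring l" for c f
    using that by (simp add: derivation_mult derivation_const)
  ultimately show ?thesis
    by (auto simp: Der_def derivation_add derivation_mult) (simp add: derivation_def)
qed

section \<open>Linear algebra of hyperplanes\<close>

lemma scale_kvec_apply [simp]: "scale_kvec a v i = a * v i"
  by (simp add: scale_kvec_def)

lemma sum_kvec_apply: "(\<Sum>i\<in>I. f i) j = (\<Sum>i\<in>I. f i j)" for f :: "'i \<Rightarrow> 'k::field kvec"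
  by (induction I rule: infinite_finite_induct) auto

lemma kvec_subspaceI:
  fixes S :: "'k::field kvec set"
  assumes "0 \<in> S" "\<And>u v. u \<in> S \<Longrightarrow> v \<in> S \<Longrightarrow> u + v \<in> S" "\<And>a v. v \<in> S \<Longrightarrow> scale_kvec a v \<in> S"
  shows "kvec.subspace S"
  using assms by (simp add: kvec.subspace_def)

lemma subspace_coord_space: "kvec.subspace (coord_space l :: 'k::field kvec set)"
  by (rule kvec_subspaceI) (auto simp: coord_space_def)

lemma form_kernel_iff: "v \<in> form_kernel l a \<longleftrightarrow> v \<in> coord_space l \<and> (\<Sum>i<l. a i * v i) = 0"
  by (simp add: form_kernel_def)

lemma subspace_form_kernel: "kvec.subspace (form_kernel l a :: 'k::field kvec set)"
proof (rule kvec_subspaceI)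
  note c = kvec.subspace_0[OF subspace_coord_space] kvec.subspace_add[OF subspace_coord_space]
    kvec.subspace_scale[OF subspace_coord_space]
  show "0 \<in> form_kernel l a" by (simp add: form_kernel_iff c)
  show "u + v \<in> form_kernel l a" if "u \<in> form_kernel l a" "v \<in> form_kernel l a" for u v
    using that by (simp add: form_kernel_iff c distrib_left sum.distrib)
  show "scale_kvec b v \<in> form_kernel l a" if "v \<in> form_kernel l a" for b v
  proof -
    have "(\<Sum>i<l. a i * scale_kvec b v i) = b * (\<Sum>i<l. a i * v i)"
      by (simp add: sum_distrib_left mult_ac)
    then show ?thesis using that by (simp add: form_kernel_iff c)
  qed
qed

lemma subspace_hyperplane: "hyperplane l H \<Longrightarrow> kvec.subspace H"
  by (auto simp: hyperplane_def subspace_form_kernel)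

lemma hyperplane_subset: "hyperplane l H \<Longrightarrow> H \<subseteq> coord_space l"
  by (auto simp: hyperplane_def form_kernel_def)

definition unit_kvec :: "nat \<Rightarrow> 'k::field kvec"
  where "unit_kvec i = (\<lambda>j. if j = i then 1 else 0)"

lemma unit_kvec_in [simp]: "unit_kvec i \<in> coord_space l \<longleftrightarrow> i < l"
  by (auto simp: unit_kvec_def coord_space_def)

lemma kvec_expansion:
  "v \<in> coord_space l \<Longrightarrow> v = (\<Sum>i<l. scale_kvec (v i) (unit_kvec i))" for v :: "'k::field kvec"
  by (rule ext) (auto simp: sum_kvec_apply unit_kvec_def coord_space_def if_distrib cong: if_cong)

lemma span_unit_kvec: "kvec.span (unit_kvec ` {..<l}) = (coord_space l :: 'k::field kvec set)"
proof
  show "kvec.span (unit_kvec ` {..<l}) \<subseteq> (coord_space l :: 'k kvec set)"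
    by (intro kvec.span_minimal subspace_coord_space) auto
  show "coord_space l \<subseteq> kvec.span (unit_kvec ` {..<l} :: 'k kvec set)"
  proof
    fix v :: "'k kvec" assume "v \<in> coord_space l"
    then have "v = (\<Sum>i<l. scale_kvec (v i) (unit_kvec i))" by (rule kvec_expansion)
    also have "\<dots> \<in> kvec.span (unit_kvec ` {..<l})"
      by (intro kvec.span_sum kvec.span_scale kvec.span_base) auto
    finally show "v \<in> kvec.span (unit_kvec ` {..<l})" .
  qed
qed

text \<open>Injectivity comes with independence: a repeated vector would satisfy the relation with
  coefficients 1 and -1.\<close>

lemma independent_family:
  fixes v :: "'i \<Rightarrow> 'k::field kvec"
  assumes fin: "finite I"
    and ind: "\<And>u i. (\<Sum>i\<in>I. scale_kvec (u i) (v i)) = 0 \<Longrightarrow> i \<in> I \<Longrightarrow> u i = 0"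
  shows "kvec.independent (v ` I) \<and> card (v ` I) = card I"
proof -
  have inj: "inj_on v I"
  proof (rule inj_onI, rule ccontr)
    fix i j assume ij: "i \<in> I" "j \<in> I" "v i = v j" "i \<noteq> j"
    define u :: "'i \<Rightarrow> 'k" where "u k = (if k = i then 1 else if k = j then - 1 else 0)" for k
    have "(\<Sum>k\<in>I. scale_kvec (u k) (v k)) = (\<Sum>k\<in>{i, j}. scale_kvec (u k) (v k))"
      by (rule sum.mono_neutral_right) (use fin ij in \<open>auto simp: u_def\<close>)
    also have "\<dots> = 0" using ij by (auto simp: u_def fun_eq_iff)
    finally show False using ind[of u i] ij by (simp add: u_def)
  qed
  have "kvec.independent (v ` I)"
  proof (rule kvec.independent_if_scalars_zero)
    show "finite (v ` I)" using fin by simp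
    fix f x assume sum0: "(\<Sum>x\<in>v ` I. scale_kvec (f x) x) = 0" and "x \<in> v ` I"
    then obtain i where i: "i \<in> I" "x = v i" by auto
    have "(\<Sum>i\<in>I. scale_kvec (f (v i)) (v i)) = 0" using sum0 by (simp add: sum.reindex[OF inj])
    then show "f x = 0" using ind[of "\<lambda>i. f (v i)" i] i by simp
  qed
  then show ?thesis by (simp add: card_image[OF inj])
qed

lemma dim_coord_space [simp]: "kvec.dim (coord_space l :: 'k::field kvec set) = l"
proof -
  have "kvec.independent (unit_kvec ` {..<l} :: 'k kvec set) \<and>
      card (unit_kvec ` {..<l} :: 'k kvec set) = card {..<l}"
  proof (rule independent_family)
    fix u :: "nat \<Rightarrow> 'k" and i
    assume "(\<Sum>i<l. scale_kvec (u i) (unit_kvec i)) = 0" and i: "i \<in> {..<l}"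
    then have "(\<Sum>j<l. scale_kvec (u j) (unit_kvec j)) i = 0" by simp
    then show "u i = 0" using i by (simp add: sum_kvec_apply unit_kvec_def if_distrib cong: if_cong)
  qed simp
  then show ?thesis
    by (metis card_lessThan kvec.dim_span_eq_card_independent span_unit_kvec)
qed

text \<open>The type of all vectors is infinite dimensional. Finiteness of the basis comes from the
  containment in \<open>coord_space l\<close>, which is spanned by \<open>l\<close> unit
  vectors.\<close>

lemma independent_extend_coord_space:
  fixes B :: "'k::field kvec set"
  assumes "B \<subseteq> V" "V \<subseteq> coord_space l" "kvec.independent B"
  obtains B' where "B \<subseteq> B'" "finite B'" "V \<subseteq> kvec.span B'" "card B' = kvec.dim V"
proof -
  obtain B' where B': "B \<subseteq> B'" "B' \<subseteq> V" "kvec.independent B'" "V \<subseteq> kvec.span B'"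
    using kvec.maximal_independent_subset_extend[OF assms(1,3)] .
  have "finite B'"
    using kvec.independent_span_bound[of "unit_kvec ` {..<l}" B'] B' assms(2)
    by (auto simp: span_unit_kvec)
  then show ?thesis using that B' kvec.basis_card_eq_dim by blast
qed

lemma independent_card_le_dim:
  fixes B :: "'k::field kvec set"
  assumes "B \<subseteq> V" "V \<subseteq> coord_space l" "kvec.independent B"
  shows "card B \<le> kvec.dim V"
  using independent_extend_coord_space[OF assms] by (metis card_mono)

lemma subspace_eqI_dim:
  fixes S T :: "'k::field kvec set"
  assumes "kvec.subspace S" "S \<subseteq> T" "T \<subseteq> coord_space l" "kvec.dim T \<le> kvec.dim S"
  shows "S = T"
proof -
  obtain B where B: "B \<subseteq> S" "kvec.independent B" "S \<subseteq> kvec.span B" "card B = kvec.dim S"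
    using kvec.basis_exists .
  obtain B' where B': "B \<subseteq> B'" "finite B'" "T \<subseteq> kvec.span B'" "card B' = kvec.dim T"
    using independent_extend_coord_space[of B T l] B assms(2,3) by blast
  have "B = B'" using B' B(4) assms(4) by (metis card_seteq)
  then have "T \<subseteq> kvec.span S" using B'(3) B(1) kvec.span_mono by blast
  then show ?thesis using assms(1,2) by (simp add: kvec.span_eq_iff[THEN iffD2])
qed

lemma hyperplane_neq_coord_space:
  fixes H :: "'k::field kvec set"
  assumes "hyperplane l H"
  shows "\<not> coord_space l \<subseteq> H"
proof
  assume sub: "coord_space l \<subseteq> H"
  obtain a where a: "a \<in> coord_space l" "a \<noteq> 0" "H = form_kernel l a"
    using assms by (auto simp: hyperplane_def)
  have "a j = 0" for j
  proof (cases "j < l")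
    case True
    then have "unit_kvec j \<in> form_kernel l a" using sub a(3) unit_kvec_in by blast
    then show ?thesis
      using True by (simp add: form_kernel_iff unit_kvec_def if_distrib cong: if_cong)
  qed (use a(1) in \<open>simp add: coord_space_def\<close>)
  then show False using a(2) by (simp add: fun_eq_iff)
qed

text \<open>If \<open>v \<in> K \<inter> K'\<close> lay outside \<open>H\<close>, then \<open>K\<close> and \<open>K'\<close> would both be spanned by \<open>v\<close> and their
  common trace on \<open>H\<close>.\<close>

lemma same_trace_imp_Int_subset:
  fixes H K K' :: "'k::field kvec set"
  assumes hyp: "hyperplane l H" "hyperplane l K" "hyperplane l K'"
    and trace: "H \<inter> K = H \<inter> K'" and neq: "K \<noteq> K'"
  shows "K \<inter> K' \<subseteq> H"
proof (rule ccontr)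
  assume "\<not> K \<inter> K' \<subseteq> H"
  then obtain v where v: "v \<in> K" "v \<in> K'" "v \<notin> H" by blast
  obtain a where H: "H = form_kernel l a" using hyp(1) by (auto simp: hyperplane_def)
  have vc: "v \<in> coord_space l" using v(1) hyp(2) hyperplane_subset by blast
  define b where "b u = (\<Sum>i<l. a i * u i)" for u
  have bv: "b v \<noteq> 0" using v(3) vc by (simp add: H form_kernel_iff b_def)
  have sub: "L \<subseteq> L'"
    if L: "hyperplane l L" "hyperplane l L'" "v \<in> L" "v \<in> L'" "H \<inter> L = H \<inter> L'" for L L'
  proof
    fix w assume w: "w \<in> L"
    \<comment> \<open>The projection of \<open>w\<close> onto \<open>H\<close> along
      \<open>v\<close>. It stays in \<open>L\<close>, hence lies in the common trace and so in
      \<open>L'\<close>; adding the multiple of \<open>v\<close> back gives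
      \<open>w\<close>.\<close>
    define w' where "w' = w - scale_kvec (b w / b v) v"
    have "w' \<in> L"
      unfolding w'_def using kvec.subspace_diff kvec.subspace_scale subspace_hyperplane[OF L(1)] w L(3)
      by blast
    moreover have "b w' = b w - b w / b v * b v"
      unfolding b_def[of w'] by (simp add: w'_def right_diff_distrib sum_subtractf
        mult.left_commute[of _ "b w / b v"] sum_distrib_left[symmetric] b_def[symmetric]
        del: times_divide_eq_left times_divide_eq_right)
    ultimately have "w' \<in> H"
      using bv L(1) hyperplane_subset by (auto simp: H form_kernel_iff b_def[symmetric])
    with \<open>w' \<in> L\<close> L(5) have "w' \<in> L'" by blast
    then have "w' + scale_kvec (b w / b v) v \<in> L'"
      using kvec.subspace_add kvec.subspace_scale subspace_hyperplane[OF L(2)] L(4) by blast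
    then show "w \<in> L'" by (simp add: w'_def)
  qed
  show False using sub[OF hyp(2,3) v(1,2) trace] sub[OF hyp(3,2) v(2,1) trace[symmetric]] neq by blast
qed

section \<open>Logarithmic derivations of low degree\<close>

lemma homogeneous_linear_form [simp]: "homogeneous (Suc 0) (linear_form l a)"
  unfolding linear_form_def by (intro homogeneous_sum homogeneous_const_mult homogeneous_var)

lemma log_der_Der: "\<theta> \<in> log_der l A \<Longrightarrow> \<theta> \<in> Der l"
  by (simp add: log_der_def)

lemma log_der_dvd:
  assumes "\<theta> \<in> log_der l A" "H \<in> A" "a \<in> coord_space l" "H = form_kernel l a"
  shows "linear_form l a dvd \<theta> (linear_form l a)"
proof -
  have "\<exists>g\<in>poly_ring l. \<theta> (linear_form l a) = linear_form l a * g"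
    using assms by (simp add: log_der_def)
  then show ?thesis by (metis dvdI)
qed

lemma log_der_basisD:
  assumes "log_der_basis l A \<theta>"
  shows log_der_basis_mem: "i \<in> {1..l} \<Longrightarrow> \<theta> i \<in> log_der l A"
    and log_der_basis_exists:
      "\<eta> \<in> log_der l A \<Longrightarrow> \<exists>g. (\<forall>i\<in>{1..l}. g i \<in> poly_ring l) \<and> (\<forall>f. \<eta> f = (\<Sum>i=1..l. g i * \<theta> i f))"
proof -
  show "i \<in> {1..l} \<Longrightarrow> \<theta> i \<in> log_der l A" using assms by (simp add: log_der_basis_def)
  assume "\<eta> \<in> log_der l A"
  then obtain g where "g \<in> {1..l} \<rightarrow>\<^sub>E poly_ring l" "\<eta> = (\<lambda>f. \<Sum>i=1..l. g i * \<theta> i f)"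
    using assms unfolding log_der_basis_def by blast
  then show "\<exists>g. (\<forall>i\<in>{1..l}. g i \<in> poly_ring l) \<and> (\<forall>f. \<eta> f = (\<Sum>i=1..l. g i * \<theta> i f))"
    by (intro exI[of _ g]) (auto simp: PiE_def Pi_def)
qed

lemma zero_in_log_der: "(\<lambda>f. 0) \<in> log_der l A"
proof -
  have "(\<lambda>f. 0 :: 'a mpoly) \<in> Der l" using Der_combination[of "{}"] by simp
  then show ?thesis by (auto simp: log_der_def intro: bexI[of _ 0])
qed

text \<open>This is uniqueness of the coordinates of the zero derivation. Testing on the variables
  suffices since they determine a derivation; \<open>restrict\<close> makes the coordinate functions
  extensional, as \<open>log_der_basis\<close> demands.\<close>

lemma log_der_basis_independent:
  assumes basis: "log_der_basis l A \<theta>"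
    and g: "\<And>i. i \<in> {1..l} \<Longrightarrow> g i \<in> poly_ring l"
    and zero: "\<And>j. j < l \<Longrightarrow> (\<Sum>i=1..l. g i * \<theta> i (poly_var j)) = 0"
    and i: "i \<in> {1..l}"
  shows "g i = 0"
proof -
  have der: "\<theta> i \<in> Der l" if "i \<in> {1..l}" for i
    using log_der_basis_mem[OF basis that] by (rule log_der_Der)
  have "(\<lambda>f. \<Sum>i=1..l. g i * \<theta> i f) = (\<lambda>f. 0)"
  proof (rule Der_eqI[of _ l])
    show "(\<lambda>f. \<Sum>i=1..l. g i * \<theta> i f) \<in> Der l" using g der by (rule Der_combination)
    show "(\<lambda>f. 0) \<in> Der l" using zero_in_log_der log_der_Der by blast
  qed (use zero in simp)
  then have *: "(\<lambda>f. 0) = (\<lambda>f. \<Sum>i=1..l. restrict g {1..l} i * \<theta> i f)" by (simp add: fun_eq_iff)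
  have **: "(\<lambda>f. 0) = (\<lambda>f. \<Sum>i=1..l. restrict (\<lambda>i. 0) {1..l} i * \<theta> i f)" by simp
  have "\<exists>!g. g \<in> {1..l} \<rightarrow>\<^sub>E poly_ring l \<and> (\<lambda>f. 0) = (\<lambda>f. \<Sum>i=1..l. g i * \<theta> i f)"
    using basis zero_in_log_der unfolding log_der_basis_def by blast
  moreover have "restrict g {1..l} \<in> {1..l} \<rightarrow>\<^sub>E poly_ring l"
    and "restrict (\<lambda>i. 0) {1..l} \<in> {1..l} \<rightarrow>\<^sub>E poly_ring l"
    using g by (auto simp: restrict_PiE_iff)
  ultimately have "restrict g {1..l} = restrict (\<lambda>i. 0) {1..l}"
    using * ** by blast
  then have "restrict g {1..l} i = restrict (\<lambda>i. 0) {1..l} i" by simp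
  then show ?thesis using i by simp
qed

text \<open>Basis elements of degree 0 are constant vector fields tangent to every hyperplane.\<close>

lemma card_zero_exponents_le_dim:
  fixes A :: "'k::field kvec set set"
  assumes exp: "exponents l A d" and hyp: "\<And>H. H \<in> A \<Longrightarrow> hyperplane l H"
  shows "card {i\<in>{1..l}. d i = 0} \<le> kvec.dim (coord_space l \<inter> \<Inter>A)"
proof -
  obtain \<theta> where basis: "log_der_basis l A \<theta>"
    and hom: "\<And>i. i \<in> {1..l} \<Longrightarrow> homogeneous_der l (d i) (\<theta> i)"
    using exp by (auto simp: exponents_def)
  define I where "I = {i\<in>{1..l}. d i = 0}"
  define v where "v i = (\<lambda>j. if j < l then Poly_Mapping.lookup (\<theta> i (poly_var j)) 0 else 0)" for i
  have \<theta>v: "\<theta> i (poly_var j) = poly_const (v i j)" if "i \<in> I" "j < l" for i j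
  proof -
    have "homogeneous 0 (\<theta> i (poly_var j))"
      using hom[of i] that by (auto simp: I_def homogeneous_der_def)
    then show ?thesis using that by (simp add: v_def homogeneous_0_imp_const[symmetric])
  qed
  have vc: "v i \<in> coord_space l" for i by (simp add: v_def coord_space_def)
  have mem: "v i \<in> H" if i: "i \<in> I" and H: "H \<in> A" for i H
  proof -
    obtain a where a: "a \<in> coord_space l" "a \<noteq> 0" "H = form_kernel l a"
      using hyp[OF H] by (auto simp: hyperplane_def)
    have \<theta>i: "\<theta> i \<in> log_der l A" using basis i by (intro log_der_basis_mem) (auto simp: I_def)
    have "\<theta> i (linear_form l a) = (\<Sum>j<l. poly_const (a j) * poly_const (v i j))"
      using i by (simp add: Der_linear_form[OF log_der_Der[OF \<theta>i]] \<theta>v)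
    also have "\<dots> = poly_const (\<Sum>j<l. a j * v i j)"
      by (induction l) (simp_all add: poly_const_add poly_const_mult)
    finally have eq: "\<theta> i (linear_form l a) = poly_const (\<Sum>j<l. a j * v i j)" .
    \<comment> \<open>A constant that is a multiple of a form of degree 1 must vanish.\<close>
    have "\<theta> i (linear_form l a) = 0"
      using log_der_dvd[OF \<theta>i H a(1,3)]
      by (intro homogeneous_eq_zero[of 0 _ "Suc 0" "linear_form l a"]) (simp_all add: eq)
    then show ?thesis using eq vc by (simp add: a(3) form_kernel_iff)
  qed
  have "kvec.independent (v ` I) \<and> card (v ` I) = card I"
  proof (rule independent_family)
    show "finite I" by (simp add: I_def)
    fix u :: "nat \<Rightarrow> 'k" and i
    assume sum0: "(\<Sum>i\<in>I. scale_kvec (u i) (v i)) = 0" and i: "i \<in> I"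
    \<comment> \<open>A linear relation among the vectors is a relation with constant coefficients
      among the basis derivations.\<close>
    define g where "g i = (if i \<in> I then poly_const (u i) else 0)" for i
    have "g i = 0"
    proof (rule log_der_basis_independent[OF basis])
      show "g i \<in> poly_ring l" for i by (simp add: g_def)
      show "i \<in> {1..l}" using i by (simp add: I_def)
      fix j assume j: "j < l"
      have "(\<Sum>i=1..l. g i * \<theta> i (poly_var j)) = (\<Sum>i\<in>I. poly_const (u i) * \<theta> i (poly_var j))"
        by (rule sum.mono_neutral_cong_right) (auto simp: g_def I_def)
      also have "\<dots> = (\<Sum>i\<in>I. poly_const (u i * v i j))"
        using j by (simp add: \<theta>v poly_const_mult)
      also have "\<dots> = poly_const ((\<Sum>i\<in>I. scale_kvec (u i) (v i)) j)"
        unfolding sum_kvec_apply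
        by (induction I rule: infinite_finite_induct) (simp_all add: poly_const_add)
      finally show "(\<Sum>i=1..l. g i * \<theta> i (poly_var j)) = 0" by (simp add: sum0)
    qed
    then show "u i = 0" using i by (simp add: g_def)
  qed
  moreover have "v ` I \<subseteq> coord_space l \<inter> \<Inter>A" using mem vc by auto
  ultimately show ?thesis
    using independent_card_le_dim[of "v ` I" "coord_space l \<inter> \<Inter>A" l] by (simp add: I_def)
qed

section \<open>MAT-free arrangements are MAT2-free\<close>

lemma restriction_insert:
  "H \<notin> A \<Longrightarrow> restriction (A \<union> {H}) H = (\<inter>) H ` A"
  by (auto simp: restriction_def)

text \<open>By pigeonhole two members of \<open>A\<close> have the same trace on \<open>H\<close>,
  and then \<open>H\<close> contains their intersection. A positive exponent in condition (3)
  supplies the strict inequality.\<close>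

lemma Inter_subset_of_restriction_less:
  fixes A :: "'k::field kvec set set"
  assumes "\<And>K. K \<in> A \<Longrightarrow> hyperplane l K" "hyperplane l H" "H \<notin> A"
    and "card (restriction (A \<union> {H}) H) < card A"
  shows "\<Inter>A \<subseteq> H"
proof -
  have "\<not> inj_on ((\<inter>) H) A"
    using assms(4) unfolding restriction_insert[OF assms(3)] by (auto simp: card_image)
  then obtain K K' where K: "K \<in> A" "K' \<in> A" "K \<noteq> K'" "H \<inter> K = H \<inter> K'"
    by (auto simp: inj_on_def)
  have "K \<inter> K' \<subseteq> H" using same_trace_imp_Int_subset[of l H K K'] assms(1,2) K by blast
  then show ?thesis using K by blast
qed

lemma Min_nonzero_exponent_less:
  fixes A :: "'k::field kvec set set"
  assumes exp: "exponents l A d" and hyp: "\<And>K. K \<in> A \<Longrightarrow> hyperplane l K" and "A \<noteq> {}"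
    and q: "1 \<le> q" "q \<le> l" and H: "\<forall>j\<in>{1..q}. hyperplane l (H j) \<and> H j \<notin> A"
    and codim: "codim l (\<Inter>j\<in>{1..q}. H j) = q" and nsub: "\<not> (\<Inter>j\<in>{1..q}. H j) \<subseteq> \<Union>A"
    and count: "\<forall>j\<in>{1..q}. int (card A) - int (card (restriction (A \<union> {H j}) (H j))) = int (d l)"
  shows "Min {i\<in>{1..l}. d i \<noteq> 0} < l - q + 1"
proof -
  define X where "X = (\<Inter>j\<in>{1..q}. H j)"
  define Z where "Z = coord_space l \<inter> \<Inter>A"
  have mono: "mono_on {1..l} d" using exp by (simp add: exponents_def)
  have subZ: "kvec.subspace Z"
    unfolding Z_def
    by (intro kvec.subspace_inter subspace_coord_space kvec.subspace_Inter)
      (use hyp subspace_hyperplane in blast)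
  have ZA: "Z \<subseteq> \<Union>A" using \<open>A \<noteq> {}\<close> by (auto simp: Z_def)
  have dimZ: "card {i\<in>{1..l}. d i = 0} \<le> kvec.dim Z"
    unfolding Z_def using exp hyp by (rule card_zero_exponents_le_dim)
  \<comment> \<open>Otherwise all exponents vanish, the centre has full dimension, and a member of
    \<open>A\<close> would be the whole space. Positivity is what makes condition (3) produce
    coinciding traces.\<close>
  have "d l \<noteq> 0"
  proof
    assume "d l = 0"
    then have "{i\<in>{1..l}. d i = 0} = {1..l}"
    proof -
      have "d i \<le> d l" if "i \<in> {1..l}" for i
        using mono_onD[OF mono that, of l] that by simp
      then show ?thesis using \<open>d l = 0\<close> by auto
    qed
    then have "Z = coord_space l"
      using dimZ by (intro subspace_eqI_dim[of _ _ l] subZ) (auto simp: Z_def)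
    then show False using \<open>A \<noteq> {}\<close> hyp hyperplane_neq_coord_space by (fastforce simp: Z_def)
  qed
  then have l_mem: "l \<in> {i\<in>{1..l}. d i \<noteq> 0}" using q by auto
  have "Z \<subseteq> X"
  proof -
    have "\<Inter>A \<subseteq> H j" if "j \<in> {1..q}" for j
    proof (rule Inter_subset_of_restriction_less[of A l])
      show "card (restriction (A \<union> {H j}) (H j)) < card A"
        using count that \<open>d l \<noteq> 0\<close> by fastforce
    qed (use hyp H that in auto)
    then show ?thesis unfolding X_def Z_def by blast
  qed
  have Xc: "X \<subseteq> coord_space l"
    using H q hyperplane_subset[of l "H 1"] by (force simp: X_def)
  show ?thesis
  proof (rule ccontr)
    assume neg: "\<not> ?thesis"
    have "{1..l - q} \<subseteq> {i\<in>{1..l}. d i = 0}"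
    proof
      fix i assume i: "i \<in> {1..l - q}"
      have "d i = 0"
      proof (rule ccontr)
        assume "d i \<noteq> 0"
        then have "Min {i\<in>{1..l}. d i \<noteq> 0} \<le> i" using i q by (intro Min_le) auto
        then show False using neg i by auto
      qed
      then show "i \<in> {i\<in>{1..l}. d i = 0}" using i by auto
    qed
    then have "card {1..l - q} \<le> card {i\<in>{1..l}. d i = 0}" by (intro card_mono) auto
    then have "l - q \<le> kvec.dim Z" using dimZ by simp
    moreover have "kvec.dim X = l - q" using codim q by (simp add: codim_def X_def)
    ultimately have "Z = X" using subZ \<open>Z \<subseteq> X\<close> Xc by (intro subspace_eqI_dim) auto
    then show False using ZA nsub by (simp add: X_def)
  qed
qed

text \<open>The induction also records that all members are hyperplanes, which the comparison of the
  centre with \<open>X\<close> requires.\<close>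

lemma MAT_free_imp_MAT2_free:
  fixes A :: "'k::field kvec set set"
  assumes "(l, A) \<in> MAT_free"
  shows "(l, A) \<in> MAT2_free \<and> (\<forall>H\<in>A. hyperplane l H)"
  using assms
proof (induction l A rule: MAT_free.induct)
  case (empty l)
  show ?case by (simp add: MAT2_free.empty)
next
  case (step l A' d p q H X)
  define s where "s = l - q + 1"
  \<comment> \<open>The shift \<open>j + 1 - s\<close> carries \<open>{s..l}\<close> onto
    \<open>{1..q}\<close>, so the new planes occupy the last \<open>q\<close> positions.\<close>
  define H' where "H' j = H (j + 1 - s)" for j
  have q: "1 \<le> q" "q \<le> l" using step.hyps by simp_all
  have "(\<lambda>j. j + 1 - s) ` {s..l} = {1..q}"
  proof -
    have "k \<in> (\<lambda>j. j + 1 - s) ` {s..l}" if "k \<in> {1..q}" for k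
      using that q by (intro image_eqI[of _ _ "k + s - 1"]) (auto simp: s_def)
    then show ?thesis using q by (auto simp: s_def)
  qed
  then have img: "H' ` {s..l} = H ` {1..q}"
    unfolding H'_def by (metis (no_types) image_image)
  have mono: "mono_on {1..l} d" using step.hyps by (simp add: exponents_def)
  \<comment> \<open>By monotonicity the \<open>p\<close> positions with the highest exponent are the
    last ones, and \<open>q \<le> p\<close> puts \<open>{s..l}\<close> among them. Thus both
    versions of condition (3) ask for the same number.\<close>
  have d_eq: "d j = d l" if j: "j \<in> {s..l}" for j
  proof (rule ccontr)
    assume ne: "d j \<noteq> d l"
    have j1: "j \<in> {1..l}" using j by (auto simp: s_def)
    have "d j \<le> d l" using mono j1 by (auto simp: mono_on_def)
    then have lt: "d j < d l" using ne by simp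
    have "{i\<in>{1..l}. d i = d l} \<subseteq> {j<..l}"
    proof
      fix i assume i: "i \<in> {i\<in>{1..l}. d i = d l}"
      have "d i \<le> d j" if "i \<le> j" using mono_onD[OF mono _ j1 that] i by simp
      then show "i \<in> {j<..l}" using i lt by fastforce
    qed
    then have "p \<le> l - j" using step.hyps card_mono[of "{j<..l}"] by fastforce
    then show False using j step.hyps by (auto simp: s_def)
  qed
  have H: "hyperplane l K \<and> K \<notin> A'" if "K \<in> H ` {1..q}" for K
    using step.hyps that by auto
  have count: "int (card A') - int (card (restriction (A' \<union> {K}) K)) = int (d l)"
    if "K \<in> H ` {1..q}" for K
    using step.hyps that by auto
  have "(l, A' \<union> H' ` {s..l}) \<in> MAT2_free"
  proof (rule MAT2_free.step)
    show "(l, A') \<in> MAT2_free" using step.IH by simp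
    show "exponents l A' d" by fact
    show "s \<le> l" "A' = {} \<longrightarrow> s > 0" using q by (simp_all add: s_def)
    show "A' \<noteq> {} \<longrightarrow> Min {i \<in> {1..l}. d i \<noteq> 0} < s"
    proof
      assume "A' \<noteq> {}"
      then show "Min {i \<in> {1..l}. d i \<noteq> 0} < s"
        unfolding s_def
        by (intro Min_nonzero_exponent_less[of l A' d q H]) (use step q in auto)
    qed
    show "\<forall>j\<in>{s..l}. hyperplane l (H' j) \<and> H' j \<notin> A'"
    proof
      fix j assume "j \<in> {s..l}"
      then have "H' j \<in> H ` {1..q}" unfolding img[symmetric] by (rule imageI)
      then show "hyperplane l (H' j) \<and> H' j \<notin> A'" by (rule H)
    qed
    show "X = (\<Inter>j\<in>{s..l}. H' j)" using step.hyps by (simp only: img)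
    show "codim l X = l - s + 1" using step.hyps q by (simp add: s_def)
    show "\<not> X \<subseteq> \<Union>A'" by fact
    show "\<forall>j\<in>{s..l}. int (card A') - int (card (restriction (A' \<union> {H' j}) (H' j))) = int (d j)"
    proof
      fix j assume j: "j \<in> {s..l}"
      then have "H' j \<in> H ` {1..q}" unfolding img[symmetric] by (rule imageI)
      then show "int (card A') - int (card (restriction (A' \<union> {H' j}) (H' j))) = int (d j)"
        using count d_eq[OF j] by simp
    qed
  qed
  then show ?case using step.IH H by (auto simp: img)
qed

section \<open>A pencil with transversals in dimension three\<close>

definition vec3 :: "'k \<Rightarrow> 'k \<Rightarrow> 'k \<Rightarrow> 'k::field kvec"
  where "vec3 a b c = (\<lambda>i. if i = 0 then a else if i = 1 then b else if i = 2 then c else 0)"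

lemma vec3_simps [simp]: "vec3 a b c 0 = a" "vec3 a b c (Suc 0) = b" "vec3 a b c 2 = c"
  by (simp_all add: vec3_def)

lemma vec3_in_coord_space [simp]: "vec3 a b c \<in> coord_space 3"
  by (simp add: vec3_def coord_space_def)

lemma sum_lessThan_3: "(\<Sum>i<3. f i) = f 0 + f 1 + f (2::nat)"
  by (simp add: eval_nat_numeral)

lemma sum_1_3: "(\<Sum>i=1..3. f i) = f 1 + f 2 + f (3::nat)"
  by (simp add: eval_nat_numeral)

lemma all_less_3: "(\<forall>i<3. P i) \<longleftrightarrow> P 0 \<and> P (Suc 0) \<and> P (2::nat)"
  by (auto simp: eval_nat_numeral less_Suc_eq)

lemma atLeastAtMost_1_3: "{1..3} = {1, 2, 3::nat}"
  by auto

definition pencil :: "'k::field \<Rightarrow> 'k kvec set"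
  where "pencil c = form_kernel 3 (vec3 1 c 0)"

text \<open>The slopes \<open>(t, t\<^sup>2)\<close> lie on a parabola, so that the transversals \<open>s\<close> and \<open>t\<close> meet on the member
  \<open>s + t\<close> of the pencil.\<close>

definition transversal :: "'k::field \<Rightarrow> 'k kvec set"
  where "transversal t = form_kernel 3 (vec3 (- t) (- (t\<^sup>2)) 1)"

definition pencil_arr :: "'k::field set \<Rightarrow> 'k set \<Rightarrow> 'k kvec set set"
  where "pencil_arr C T = pencil ` C \<union> transversal ` T"

abbreviation "x\<^sub>0 \<equiv> poly_var 0"
abbreviation "x\<^sub>1 \<equiv> poly_var (Suc 0)"
abbreviation "x\<^sub>2 \<equiv> poly_var 2"

definition pencil_form :: "'k::field \<Rightarrow> 'k mpoly"
  where "pencil_form c = x\<^sub>0 + poly_const c * x\<^sub>1"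

definition transversal_form :: "'k::field \<Rightarrow> 'k mpoly"
  where "transversal_form t = x\<^sub>2 - poly_const t * x\<^sub>0 - poly_const (t\<^sup>2) * x\<^sub>1"

lemma linear_form_pencil: "linear_form 3 (vec3 1 c 0) = pencil_form c"
  by (simp add: linear_form_def pencil_form_def sum_lessThan_3)

lemma linear_form_transversal:
  "linear_form 3 (vec3 (- t) (- (t\<^sup>2)) 1) = transversal_form t"
  by (simp add: linear_form_def transversal_form_def sum_lessThan_3)

lemma pencil_form_in_ring [simp]: "pencil_form c \<in> poly_ring 3"
  by (simp add: pencil_form_def)

lemma transversal_form_in_ring [simp]: "transversal_form t \<in> poly_ring 3"
  by (simp add: transversal_form_def)

lemma homogeneous_pencil_form [simp]: "homogeneous (Suc 0) (pencil_form c)"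
  by (simp add: pencil_form_def)

lemma homogeneous_transversal_form [simp]: "homogeneous (Suc 0) (transversal_form t)"
  by (simp add: transversal_form_def)

lemma pencil_form_0 [simp]: "pencil_form 0 = x\<^sub>0"
  by (simp add: pencil_form_def)

subsection \<open>Divisibility by linear forms\<close>

lemma ex_poly_ring: "\<exists>l. f \<in> poly_ring l"
proof -
  have "finite (\<Union>m\<in>Poly_Mapping.keys f. Poly_Mapping.keys m)" by simp
  then obtain l where "\<forall>i\<in>(\<Union>m\<in>Poly_Mapping.keys f. Poly_Mapping.keys m). i < l"
    using finite_nat_set_iff_bounded by blast
  then have "f \<in> poly_ring l" by (auto simp: poly_ring_def)
  then show ?thesis ..
qed

text \<open>Under these hypotheses \<sigma> is reduction modulo \<open>a\<close>, since
  \<open>f\<close> and its image always differ by a multiple of \<open>a\<close>. Divisibility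
  becomes the vanishing of a homomorphism into a domain, so the linear forms are seen to be prime
  without any factorization theory.\<close>

lemma dvd_iff_subst_eq_0:
  fixes \<sigma> :: "nat \<Rightarrow> 'k::field mpoly"
  assumes var: "\<And>i. a dvd poly_var i - \<sigma> i" and a: "mpoly_eval poly_const \<sigma> a = 0"
  shows "a dvd f \<longleftrightarrow> mpoly_eval poly_const \<sigma> f = 0"
proof
  show "mpoly_eval poly_const \<sigma> f = 0" if "a dvd f"
    using that a by (auto elim!: dvdE)
  obtain l where "f \<in> poly_ring l" using ex_poly_ring by blast
  then have dvd: "a dvd f - mpoly_eval poly_const \<sigma> f"
  proof (induction rule: poly_ring_induct)
    case (add f g)
    have "f + g - mpoly_eval poly_const \<sigma> (f + g) =
        (f - mpoly_eval poly_const \<sigma> f) + (g - mpoly_eval poly_const \<sigma> g)" by simp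
    then show ?case using add by (metis dvd_add)
  next
    case (mult f g)
    have "f * g - mpoly_eval poly_const \<sigma> (f * g) = (f - mpoly_eval poly_const \<sigma> f) * g
        + mpoly_eval poly_const \<sigma> f * (g - mpoly_eval poly_const \<sigma> g)"
      by (simp add: algebra_simps)
    then show ?case using mult by (metis dvd_add dvd_mult dvd_mult2)
  qed (use var in simp_all)
  show "a dvd f" if "mpoly_eval poly_const \<sigma> f = 0"
    using dvd that by simp
qed

definition pencil_subst :: "'k::field \<Rightarrow> nat \<Rightarrow> 'k mpoly"
  where "pencil_subst c = poly_var(0 := - (poly_const c * x\<^sub>1))"

definition transversal_subst :: "'k::field \<Rightarrow> nat \<Rightarrow> 'k mpoly"
  where "transversal_subst t = poly_var(2 := poly_const t * x\<^sub>0 + poly_const (t\<^sup>2) * x\<^sub>1)"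

lemma pencil_form_dvd_iff:
  "pencil_form c dvd f \<longleftrightarrow> mpoly_eval poly_const (pencil_subst c) f = 0"
  by (rule dvd_iff_subst_eq_0) (simp_all add: pencil_subst_def pencil_form_def)

lemma transversal_form_dvd_iff:
  "transversal_form t dvd f \<longleftrightarrow> mpoly_eval poly_const (transversal_subst t) f = 0"
  by (rule dvd_iff_subst_eq_0)
    (simp_all add: transversal_subst_def transversal_form_def algebra_simps)

lemma pencil_form_dvd_mult_iff:
  "pencil_form c dvd f * g \<longleftrightarrow> pencil_form c dvd f \<or> pencil_form c dvd g"
  by (simp add: pencil_form_dvd_iff)

lemma transversal_form_dvd_mult_iff:
  "transversal_form t dvd f * g \<longleftrightarrow> transversal_form t dvd f \<or> transversal_form t dvd g"
  by (simp add: transversal_form_dvd_iff)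

lemma pencil_form_dvd_prod_iff:
  "finite I \<Longrightarrow> pencil_form c dvd (\<Prod>i\<in>I. f i) \<longleftrightarrow> (\<exists>i\<in>I. pencil_form c dvd f i)"
  by (simp add: pencil_form_dvd_iff)

lemma transversal_form_dvd_prod_iff:
  "finite I \<Longrightarrow> transversal_form t dvd (\<Prod>i\<in>I. f i) \<longleftrightarrow> (\<exists>i\<in>I. transversal_form t dvd f i)"
  by (simp add: transversal_form_dvd_iff)

lemma not_dvd_point:
  assumes "mpoly_eval id v a = 0" "mpoly_eval id v f \<noteq> 0"
  shows "\<not> a dvd f"
  using assms by (auto elim!: dvdE)

lemma pencil_form_dvd_pencil_form_iff [simp]: "pencil_form c dvd pencil_form c' \<longleftrightarrow> c = c'"
  using not_dvd_point[of "vec3 (- c) 1 0" "pencil_form c" "pencil_form c'"]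
  by (auto simp: pencil_form_def)

lemma transversal_form_dvd_transversal_form_iff [simp]:
  "transversal_form t dvd transversal_form s \<longleftrightarrow> t = s"
  using not_dvd_point[of "vec3 1 0 t" "transversal_form t" "transversal_form s"]
  by (auto simp: transversal_form_def)

lemma pencil_form_not_dvd_transversal_form [simp]: "\<not> pencil_form c dvd transversal_form t"
  \<comment> \<open>At this point the pencil form vanishes and the transversal form has the value
    1.\<close>
  by (rule not_dvd_point[of "vec3 (- c) 1 (1 - t * c + t\<^sup>2)"])
    (simp_all add: pencil_form_def transversal_form_def algebra_simps)

lemma x0_not_dvd_x1: "\<not> x\<^sub>0 dvd (x\<^sub>1 :: 'k::field mpoly)"
  by (rule not_dvd_point[of "vec3 0 1 0"]) simp_all

lemma poly_var_neq_0 [simp]: "poly_var i \<noteq> (0 :: 'k::field mpoly)"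
proof
  assume "poly_var i = (0 :: 'k mpoly)"
  then have "mpoly_eval id (\<lambda>_. 1) (poly_var i) = mpoly_eval id (\<lambda>_. 1) (0 :: 'k mpoly)" by simp
  then show False by simp
qed

lemma pencil_form_neq_0 [simp]: "pencil_form c \<noteq> 0"
proof
  assume "pencil_form c = 0"
  then have "pencil_form (c + 1) dvd pencil_form c" by simp
  then show False by (simp only: pencil_form_dvd_pencil_form_iff) simp
qed

lemma transversal_form_neq_0 [simp]: "transversal_form t \<noteq> 0"
  using pencil_form_not_dvd_transversal_form[of 0 t] by (metis dvd_0_right)

lemma prod_dvd_of_dvd:
  fixes a :: "'i \<Rightarrow> 'a::idom"
  assumes "finite I" "\<And>i. i \<in> I \<Longrightarrow> a i dvd f"
    and prime: "\<And>i g h. i \<in> I \<Longrightarrow> a i dvd g * h \<Longrightarrow> a i dvd g \<or> a i dvd h"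
    and not_dvd: "\<And>i J. i \<in> I \<Longrightarrow> J \<subseteq> I - {i} \<Longrightarrow> \<not> a i dvd (\<Prod>j\<in>J. a j)"
  shows "(\<Prod>i\<in>I. a i) dvd f"
proof -
  have "J \<subseteq> I \<Longrightarrow> (\<Prod>i\<in>J. a i) dvd f" if "finite J" for J
    using that
  proof (induction J rule: finite_induct)
    case (insert i J)
    then have i: "i \<in> I" "J \<subseteq> I - {i}" and "(\<Prod>i\<in>J. a i) dvd f" by auto
    from this(3) obtain g where g: "f = (\<Prod>i\<in>J. a i) * g" by (elim dvdE)
    have "a i dvd (\<Prod>i\<in>J. a i) * g" using assms(2)[OF i(1)] unfolding g .
    then have "a i dvd g" using prime[OF i(1)] not_dvd[OF i] by blast
    then obtain h where "g = a i * h" by (elim dvdE)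
    then have "f = (\<Prod>i\<in>insert i J. a i) * h" using insert.hyps g by (simp add: mult_ac)
    then show ?case by simp
  qed simp
  then show ?thesis using assms(1) by blast
qed

lemma prod_pencil_form_dvd:
  assumes "finite C" "\<And>c. c \<in> C \<Longrightarrow> pencil_form c dvd f"
  shows "(\<Prod>c\<in>C. pencil_form c) dvd f"
proof (rule prod_dvd_of_dvd[OF assms])
  show "\<not> pencil_form c dvd (\<Prod>c\<in>J. pencil_form c)" if "J \<subseteq> C - {c}" for c J
    using that finite_subset[OF that] \<open>finite C\<close> by (auto simp: pencil_form_dvd_prod_iff)
qed (auto simp: pencil_form_dvd_mult_iff)

lemma prod_transversal_form_dvd:
  assumes "finite T" "\<And>t. t \<in> T \<Longrightarrow> transversal_form t dvd f"
  shows "(\<Prod>t\<in>T. transversal_form t) dvd f"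
proof (rule prod_dvd_of_dvd[OF assms])
  show "\<not> transversal_form t dvd (\<Prod>t\<in>J. transversal_form t)" if "J \<subseteq> T - {t}" for t J
    using that finite_subset[OF that] \<open>finite T\<close>
    by (auto simp: transversal_form_dvd_prod_iff)
qed (auto simp: transversal_form_dvd_mult_iff)

subsection \<open>Derivations tangent to the arrangement\<close>

text \<open>With \<open>b k\<close> nonzero, the kernel of \<open>b\<close> contains
  \<open>e_i - (b_i / b_k) e_k\<close> for all \<open>i\<close>. Vanishing of \<open>a\<close> on
  these vectors expresses each coefficient of \<open>a\<close> through that of
  \<open>b\<close>.\<close>

lemma form_kernel_eq_imp_scale:
  fixes a b :: "'k::field kvec"
  assumes "a \<in> coord_space l" "b \<in> coord_space l" "b \<noteq> 0" "form_kernel l b \<subseteq> form_kernel l a"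
  shows "\<exists>r. a = scale_kvec r b"
proof -
  obtain k where k: "b k \<noteq> 0" using assms(3) by (auto simp: fun_eq_iff)
  then have kl: "k < l" using assms(2) by (auto simp: coord_space_def not_le)
  have less: "a i = a k / b k * b i" if "i < l" for i
  proof -
    define v where "v = unit_kvec i - scale_kvec (b i / b k) (unit_kvec k)"
    have ev: "(\<Sum>j<l. f j * v j) = f i - f k * (b i / b k)" for f
    proof -
      have unit: "(\<Sum>j<l. f j * unit_kvec m j) = f m" if "m < l" for m
        using that by (simp add: unit_kvec_def if_distrib cong: if_cong)
      have "(\<Sum>j<l. f j * v j) =
          (\<Sum>j<l. f j * unit_kvec i j) - b i / b k * (\<Sum>j<l. f j * unit_kvec k j)"
        unfolding sum_distrib_left sum_subtractf[symmetric]
        by (intro sum.cong refl) (simp add: v_def algebra_simps)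
      then show ?thesis using unit[OF kl] unit[OF that] by (simp add: mult.commute)
    qed
    have "v \<in> coord_space l"
      unfolding v_def using kl that
      by (intro kvec.subspace_diff kvec.subspace_scale subspace_coord_space) simp_all
    then have "v \<in> form_kernel l b"
      using k by (simp add: form_kernel_iff ev)
    then have "(\<Sum>j<l. a j * v j) = 0" using assms(4) by (auto simp: form_kernel_iff)
    then show ?thesis by (simp add: ev)
  qed
  have "a = scale_kvec (a k / b k) b"
  proof
    fix i
    show "a i = scale_kvec (a k / b k) b i"
    proof (cases "i < l")
      case True
      then show ?thesis unfolding scale_kvec_apply by (rule less)
    next
      case False
      then show ?thesis using assms(1,2) by (simp add: coord_space_def not_less)
    qed
  qed
  then show ?thesis by blast
qed

lemma linear_form_scale: "linear_form l (scale_kvec r b) = poly_const r * linear_form l b"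
  by (simp add: linear_form_def poly_const_mult sum_distrib_left mult_ac)

text \<open>Forms with the same kernel are proportional, so one of them may be tested. That the
  cofactor lies in the ring is automatic by \<open>poly_ring_cofactor\<close>.\<close>

lemma log_der_condition_iff:
  assumes \<theta>: "\<theta> \<in> Der l" and b: "b \<in> coord_space l" "b \<noteq> 0"
  shows "(\<forall>a\<in>coord_space l. form_kernel l b = form_kernel l a \<longrightarrow>
      (\<exists>g\<in>poly_ring l. \<theta> (linear_form l a) = linear_form l a * g)) \<longleftrightarrow>
    linear_form l b dvd \<theta> (linear_form l b)"
proof
  assume "\<forall>a\<in>coord_space l. form_kernel l b = form_kernel l a \<longrightarrow>
      (\<exists>g\<in>poly_ring l. \<theta> (linear_form l a) = linear_form l a * g)"
  then show "linear_form l b dvd \<theta> (linear_form l b)" using b(1) by (metis dvd_triv_left)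
next
  assume "linear_form l b dvd \<theta> (linear_form l b)"
  then obtain g where g: "\<theta> (linear_form l b) = linear_form l b * g" by (elim dvdE)
  have "linear_form l b \<noteq> 0"
  proof
    assume "linear_form l b = 0"
    then have "b i = 0" for i
      using b(1) by (cases "i < l") (simp_all add: linear_form_eq_0_iff coord_space_def)
    then show False using b(2) by (simp add: fun_eq_iff)
  qed
  moreover have "\<theta> (linear_form l b) \<in> poly_ring l" using \<theta> by (rule Der_in) simp
  ultimately have "g \<in> poly_ring l" using g by (intro poly_ring_cofactor[of "linear_form l b" g]) auto
  moreover have "\<theta> (linear_form l a) = linear_form l a * g"
    if a: "a \<in> coord_space l" and eq: "form_kernel l b = form_kernel l a" for a
  proof -
    obtain r where "a = scale_kvec r b"
      using form_kernel_eq_imp_scale[OF a b eq_refl[OF eq]] by blast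
    then show ?thesis by (simp add: linear_form_scale Der_scale[OF \<theta>] g)
  qed
  ultimately show "\<forall>a\<in>coord_space l. form_kernel l b = form_kernel l a \<longrightarrow>
      (\<exists>g\<in>poly_ring l. \<theta> (linear_form l a) = linear_form l a * g)" by blast
qed

lemma log_der_pencil_arr_iff:
  "\<theta> \<in> log_der 3 (pencil_arr C T) \<longleftrightarrow> \<theta> \<in> Der 3 \<and>
    (\<forall>c\<in>C. pencil_form c dvd \<theta> x\<^sub>0 + poly_const c * \<theta> x\<^sub>1) \<and>
    (\<forall>t\<in>T. transversal_form t dvd \<theta> x\<^sub>2 - poly_const t * \<theta> x\<^sub>0 - poly_const (t\<^sup>2) * \<theta> x\<^sub>1)"
proof (cases "\<theta> \<in> Der 3")
  case True
  have c: "\<theta> (pencil_form c) = \<theta> x\<^sub>0 + poly_const c * \<theta> x\<^sub>1" for c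
    using Der_linear_form[OF True, of "vec3 1 c 0"]
    by (simp add: linear_form_pencil sum_lessThan_3)
  have t: "\<theta> (transversal_form t) = \<theta> x\<^sub>2 - poly_const t * \<theta> x\<^sub>0 - poly_const (t\<^sup>2) * \<theta> x\<^sub>1" for t
    using Der_linear_form[OF True, of "vec3 (- t) (- (t\<^sup>2)) 1"]
    by (simp add: linear_form_transversal sum_lessThan_3)
  have "vec3 1 c 0 \<noteq> 0" "vec3 a b 1 \<noteq> 0" for a b c :: 'a
    using vec3_simps zero_neq_one zero_fun_apply by metis+
  note iff = log_der_condition_iff[OF True vec3_in_coord_space this(1)]
    log_der_condition_iff[OF True vec3_in_coord_space this(2)]
  show ?thesis
    unfolding log_der_def pencil_arr_def
    using True
    by (simp add: ball_Un pencil_def transversal_def iff linear_form_pencil linear_form_transversal c t)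
qed (simp add: log_der_def)

definition der3 :: "'k::field mpoly \<Rightarrow> 'k mpoly \<Rightarrow> 'k mpoly \<Rightarrow> 'k mpoly \<Rightarrow> 'k mpoly"
  where "der3 f g h = derivation 3 (\<lambda>i. if i = 0 then f else if i = Suc 0 then g else h)"

lemma der3_simps [simp]: "der3 f g h x\<^sub>0 = f" "der3 f g h x\<^sub>1 = g" "der3 f g h x\<^sub>2 = h"
  by (simp_all add: der3_def)

lemma der3_in_Der [simp]:
  "f \<in> poly_ring 3 \<Longrightarrow> g \<in> poly_ring 3 \<Longrightarrow> h \<in> poly_ring 3 \<Longrightarrow> der3 f g h \<in> Der 3"
  unfolding der3_def by (rule derivation_in_Der) simp

lemma homogeneous_der_3:
  "homogeneous_der 3 n \<theta> \<longleftrightarrow> homogeneous n (\<theta> x\<^sub>0) \<and> homogeneous n (\<theta> x\<^sub>1) \<and> homogeneous n (\<theta> x\<^sub>2)"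
  by (simp add: homogeneous_der_def all_less_3)

lemma Der_in_3:
  assumes "\<theta> \<in> Der 3"
  shows "\<theta> x\<^sub>0 \<in> poly_ring 3" "\<theta> x\<^sub>1 \<in> poly_ring 3" "\<theta> x\<^sub>2 \<in> poly_ring 3"
  by (simp_all add: Der_in[OF assms])

definition euler :: "'k::field mpoly \<Rightarrow> 'k mpoly"
  where "euler = der3 x\<^sub>0 x\<^sub>1 x\<^sub>2"

lemma euler_in_log_der: "euler \<in> log_der 3 (pencil_arr C T)"
  unfolding log_der_pencil_arr_iff
  by (simp add: euler_def flip: pencil_form_def transversal_form_def)

definition pencil_prod :: "'k::field set \<Rightarrow> 'k mpoly"
  where "pencil_prod C = (\<Prod>c\<in>C. pencil_form c)"

definition transversal_prod :: "'k::field set \<Rightarrow> 'k mpoly"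
  where "transversal_prod T = (\<Prod>t\<in>T. transversal_form t)"

lemma pencil_prod_in_ring [simp]: "pencil_prod C \<in> poly_ring 3"
  by (simp add: pencil_prod_def)

lemma transversal_prod_in_ring [simp]: "transversal_prod T \<in> poly_ring 3"
  by (simp add: transversal_prod_def)

lemma pencil_prod_neq_0 [simp]: "pencil_prod C \<noteq> 0"
  by (cases "finite C") (simp_all add: pencil_prod_def)

lemma transversal_prod_neq_0 [simp]: "transversal_prod T \<noteq> 0"
  by (cases "finite T") (simp_all add: transversal_prod_def)

lemma homogeneous_pencil_prod: "homogeneous (card C) (pencil_prod C)"
  unfolding pencil_prod_def by (rule homogeneous_prod_linear) auto

lemma homogeneous_transversal_prod: "homogeneous (card T) (transversal_prod T)"
  unfolding transversal_prod_def by (rule homogeneous_prod_linear) auto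

lemma pencil_form_dvd_pencil_prod_iff:
  "finite C \<Longrightarrow> pencil_form c dvd pencil_prod C \<longleftrightarrow> c \<in> C"
  by (auto simp: pencil_prod_def pencil_form_dvd_prod_iff)

lemma pencil_form_not_dvd_transversal_prod:
  "finite T \<Longrightarrow> \<not> pencil_form c dvd transversal_prod T"
  by (simp add: transversal_prod_def pencil_form_dvd_prod_iff)

lemma transversal_form_dvd_transversal_prod:
  "finite T \<Longrightarrow> t \<in> T \<Longrightarrow> transversal_form t dvd transversal_prod T"
  by (simp add: transversal_prod_def dvd_prodI)

text \<open>The expression is the minor of \<open>euler\<close> and \<eta> in the first two
  coordinates. Subtracting \<open>x\<^sub>1\<close> times the value of \<eta> on a pencil form from
  \<open>\<eta> x\<^sub>1\<close> times that form gives this minor, so every form of the pencil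
  divides it.\<close>

lemma pencil_prod_dvd_minor:
  assumes \<eta>: "\<eta> \<in> log_der 3 (pencil_arr C T)" and "finite C"
  shows "pencil_prod C dvd x\<^sub>0 * \<eta> x\<^sub>1 - x\<^sub>1 * \<eta> x\<^sub>0"
  unfolding pencil_prod_def
proof (rule prod_pencil_form_dvd[OF \<open>finite C\<close>])
  fix c assume "c \<in> C"
  then have "pencil_form c dvd \<eta> x\<^sub>0 + poly_const c * \<eta> x\<^sub>1"
    using \<eta> by (simp add: log_der_pencil_arr_iff)
  then have "pencil_form c dvd pencil_form c * \<eta> x\<^sub>1 - x\<^sub>1 * (\<eta> x\<^sub>0 + poly_const c * \<eta> x\<^sub>1)"
    by (metis dvd_diff dvd_mult dvd_triv_left)
  also have "\<dots> = x\<^sub>0 * \<eta> x\<^sub>1 - x\<^sub>1 * \<eta> x\<^sub>0" by (simp add: pencil_form_def algebra_simps)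
  finally show "pencil_form c dvd x\<^sub>0 * \<eta> x\<^sub>1 - x\<^sub>1 * \<eta> x\<^sub>0" .
qed

text \<open>Since \<open>x\<^sub>0\<close> and \<open>x\<^sub>1\<close> are coprime, \<eta> agrees
  on them with a multiple of \<open>euler\<close>. After subtracting this multiple only the last
  coefficient is left, and tangency makes it divisible by every transversal form.\<close>

lemma zero_minor_decomposition:
  assumes \<eta>: "\<eta> \<in> log_der 3 (pencil_arr C T)" and "finite T"
    and minor: "x\<^sub>0 * \<eta> x\<^sub>1 = x\<^sub>1 * \<eta> x\<^sub>0"
  obtains e r where "e \<in> poly_ring 3" "r \<in> poly_ring 3" "\<eta> x\<^sub>0 = e * x\<^sub>0" "\<eta> x\<^sub>1 = e * x\<^sub>1"
    "\<eta> x\<^sub>2 = e * x\<^sub>2 + r * transversal_prod T"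
proof -
  have der: "\<eta> \<in> Der 3" using \<eta> by (rule log_der_Der)
  have "x\<^sub>0 dvd x\<^sub>1 * \<eta> x\<^sub>0" using minor by (metis dvd_triv_left)
  then have "x\<^sub>0 dvd \<eta> x\<^sub>0"
    using pencil_form_dvd_mult_iff[of 0 "x\<^sub>1" "\<eta> x\<^sub>0"] by (simp add: x0_not_dvd_x1)
  then obtain e where e0: "\<eta> x\<^sub>0 = x\<^sub>0 * e" by (elim dvdE)
  have e1: "\<eta> x\<^sub>1 = x\<^sub>1 * e"
  proof -
    have "x\<^sub>0 * \<eta> x\<^sub>1 = x\<^sub>0 * (x\<^sub>1 * e)" using minor e0 by (simp add: mult_ac)
    then show ?thesis by (metis mult_left_cancel poly_var_neq_0)
  qed
  have e: "e \<in> poly_ring 3"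
    using poly_ring_cofactor[of "x\<^sub>0" e 3] Der_in_3[OF der] e0 by simp
  have "transversal_prod T dvd \<eta> x\<^sub>2 - e * x\<^sub>2"
    unfolding transversal_prod_def
  proof (rule prod_transversal_form_dvd[OF \<open>finite T\<close>])
    fix t assume "t \<in> T"
    then have "transversal_form t dvd \<eta> x\<^sub>2 - poly_const t * \<eta> x\<^sub>0 - poly_const (t\<^sup>2) * \<eta> x\<^sub>1"
      using \<eta> by (simp add: log_der_pencil_arr_iff)
    then have "transversal_form t dvd \<eta> x\<^sub>2 - poly_const t * \<eta> x\<^sub>0 - poly_const (t\<^sup>2) * \<eta> x\<^sub>1
        - e * transversal_form t"
      by (rule dvd_diff) simp
    also have "\<dots> = \<eta> x\<^sub>2 - e * x\<^sub>2"
      by (simp add: transversal_form_def e0 e1 algebra_simps)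
    finally show "transversal_form t dvd \<eta> x\<^sub>2 - e * x\<^sub>2" .
  qed
  then obtain r where r: "\<eta> x\<^sub>2 - e * x\<^sub>2 = transversal_prod T * r" by (elim dvdE)
  have "\<eta> x\<^sub>2 - e * x\<^sub>2 \<in> poly_ring 3" using Der_in_3[OF der] e by simp
  then have "r \<in> poly_ring 3"
    unfolding r by (rule poly_ring_cofactor) simp_all
  moreover have "\<eta> x\<^sub>2 = e * x\<^sub>2 + r * transversal_prod T"
    using r by (simp add: algebra_simps)
  ultimately show ?thesis using that e e0 e1 by (simp add: mult.commute)
qed

subsection \<open>Bases and exponents\<close>

text \<open>The third basis element is tangent to the pencil for any choice of its last coefficient; tangency
  to the transversals prescribes the values of the latter on them, which Lagrange interpolation
  realises by a polynomial because \<open>s + t\<close> belongs to the pencil.\<close>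

definition lagrange_coeff :: "'k::field \<Rightarrow> 'k set \<Rightarrow> 'k set \<Rightarrow> 'k mpoly"
  where "lagrange_coeff c\<^sub>0 C T = (\<Sum>t\<in>T. poly_const (t * (t - c\<^sub>0) / (\<Prod>s\<in>T - {t}. t - s)) *
    pencil_prod (C - {c\<^sub>0} - (+) t ` (T - {t})) * transversal_prod (T - {t}))"

definition lagrange_der :: "'k::field \<Rightarrow> 'k set \<Rightarrow> 'k set \<Rightarrow> 'k mpoly \<Rightarrow> 'k mpoly"
  where "lagrange_der c\<^sub>0 C T = der3 (- (poly_const c\<^sub>0 * pencil_prod (C - {c\<^sub>0})))
    (pencil_prod (C - {c\<^sub>0})) (lagrange_coeff c\<^sub>0 C T)"

text \<open>\<open>c\<^sub>0\<close> is the member left out of the product in the third basis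
  element. The sums have to avoid it, so that their forms remain available as factors in the
  interpolation.\<close>

definition interpolable :: "'k::field \<Rightarrow> 'k set \<Rightarrow> 'k set \<Rightarrow> bool"
  where "interpolable c\<^sub>0 C T \<longleftrightarrow> finite C \<and> finite T \<and> c\<^sub>0 \<in> C \<and>
    (\<forall>s\<in>T. \<forall>t\<in>T. s \<noteq> t \<longrightarrow> s + t \<in> C - {c\<^sub>0})"

lemma lagrange_coeff_in_ring [simp]: "lagrange_coeff c\<^sub>0 C T \<in> poly_ring 3"
  unfolding lagrange_coeff_def by (intro poly_ring_sum poly_ring_mult) simp_all

lemma lagrange_der_simps [simp]:
  "lagrange_der c\<^sub>0 C T x\<^sub>0 = - (poly_const c\<^sub>0 * pencil_prod (C - {c\<^sub>0}))"
  "lagrange_der c\<^sub>0 C T x\<^sub>1 = pencil_prod (C - {c\<^sub>0})"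
  "lagrange_der c\<^sub>0 C T x\<^sub>2 = lagrange_coeff c\<^sub>0 C T"
  by (simp_all add: lagrange_der_def)

lemma pencil_prod_remove:
  "finite C \<Longrightarrow> c \<in> C \<Longrightarrow> pencil_prod C = pencil_form c * pencil_prod (C - {c})"
  by (simp add: pencil_prod_def prod.remove)

text \<open>On the transversal \<open>t\<close> all terms of the sum except that of \<open>t\<close>
  vanish. In the latter, the other transversal forms restrict to forms of the pencil, which complete
  the truncated pencil product.\<close>

lemma transversal_form_dvd_lagrange:
  assumes ip: "interpolable c\<^sub>0 C T" and t: "t \<in> T"
  shows "transversal_form t dvd
    lagrange_coeff c\<^sub>0 C T - poly_const (t * (t - c\<^sub>0)) * pencil_prod (C - {c\<^sub>0})"
proof -
  have fin: "finite C" "finite T" using ip by (simp_all add: interpolable_def)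
  define ev where "ev = mpoly_eval poly_const (transversal_subst t)"
  have ev_mult: "ev (f * g) = ev f * ev g" and ev_const: "ev (poly_const a) = poly_const a" for f g a
    by (simp_all add: ev_def)
  have ev_pencil: "ev (pencil_form c) = pencil_form c" for c
    by (simp add: ev_def pencil_form_def transversal_subst_def)
  have ev_pencil_prod: "ev (pencil_prod D) = pencil_prod D" for D
    using ev_pencil by (simp add: pencil_prod_def ev_def)
  \<comment> \<open>Here the parabola enters: a difference of squares splits off
    \<open>t - s\<close> and leaves the member \<open>t + s\<close>.\<close>
  have ev_trans: "ev (transversal_form s) = poly_const (t - s) * pencil_form (t + s)" for s
    by (simp add: ev_def transversal_form_def transversal_subst_def pencil_form_def
        poly_const_add poly_const_diff poly_const_mult power2_eq_square algebra_simps)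
  have other: "ev (transversal_prod (T - {s})) = 0" if "s \<in> T" "s \<noteq> t" for s
  proof -
    have "transversal_form t dvd transversal_prod (T - {s})"
      using fin t that by (intro transversal_form_dvd_transversal_prod) auto
    then show ?thesis by (simp add: transversal_form_dvd_iff ev_def)
  qed
  have ev_prod: "ev (transversal_prod (T - {t})) =
      poly_const (\<Prod>s\<in>T - {t}. t - s) * pencil_prod ((+) t ` (T - {t}))"
  proof -
    have "ev (transversal_prod (T - {t})) = (\<Prod>s\<in>T - {t}. ev (transversal_form s))"
      by (simp add: transversal_prod_def ev_def)
    also have "\<dots> = (\<Prod>s\<in>T - {t}. poly_const (t - s)) * (\<Prod>s\<in>T - {t}. pencil_form (t + s))"
      by (simp add: ev_trans prod.distrib)
    also have "(\<Prod>s\<in>T - {t}. pencil_form (t + s)) = pencil_prod ((+) t ` (T - {t}))"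
      by (simp add: pencil_prod_def prod.reindex)
    finally show ?thesis by (simp add: poly_const_prod)
  qed
  have sub: "(+) t ` (T - {t}) \<subseteq> C - {c\<^sub>0}" using ip t by (auto simp: interpolable_def)
  have split: "pencil_prod (C - {c\<^sub>0} - (+) t ` (T - {t})) * pencil_prod ((+) t ` (T - {t})) =
      pencil_prod (C - {c\<^sub>0})"
    unfolding pencil_prod_def using fin by (intro prod.subset_diff[OF sub, symmetric]) simp
  have nz: "(\<Prod>s\<in>T - {t}. t - s) \<noteq> 0" using fin by simp
  define F where "F s = poly_const (s * (s - c\<^sub>0) / (\<Prod>r\<in>T - {s}. s - r)) *
    pencil_prod (C - {c\<^sub>0} - (+) s ` (T - {s})) * transversal_prod (T - {s})" for s
  have "ev (lagrange_coeff c\<^sub>0 C T) = (\<Sum>s\<in>T. ev (F s))"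
    by (simp add: lagrange_coeff_def F_def ev_def)
  also have "\<dots> = ev (F t) + (\<Sum>s\<in>T - {t}. ev (F s))" using fin t by (simp add: sum.remove)
  also have "(\<Sum>s\<in>T - {t}. ev (F s)) = 0"
    using other by (intro sum.neutral) (simp add: F_def ev_def)
  also have "ev (F t) = poly_const (t * (t - c\<^sub>0) / (\<Prod>r\<in>T - {t}. t - r)) *
      pencil_prod (C - {c\<^sub>0} - (+) t ` (T - {t})) *
      (poly_const (\<Prod>s\<in>T - {t}. t - s) * pencil_prod ((+) t ` (T - {t})))"
    by (simp only: F_def ev_mult ev_const ev_prod ev_pencil_prod)
  also have "\<dots> = poly_const (t * (t - c\<^sub>0) / (\<Prod>r\<in>T - {t}. t - r) * (\<Prod>s\<in>T - {t}. t - s)) *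
      (pencil_prod (C - {c\<^sub>0} - (+) t ` (T - {t})) * pencil_prod ((+) t ` (T - {t})))"
    by (simp only: poly_const_mult mult_ac)
  also have "\<dots> = poly_const (t * (t - c\<^sub>0)) * pencil_prod (C - {c\<^sub>0})"
    using nz by (simp add: split)
  finally have "ev (lagrange_coeff c\<^sub>0 C T) = poly_const (t * (t - c\<^sub>0)) * pencil_prod (C - {c\<^sub>0})"
    by simp
  then show ?thesis
    using ev_pencil_prod by (simp add: transversal_form_dvd_iff ev_def)
qed

text \<open>On the form of \<open>c\<close> the derivation takes the value
  \<open>c - c\<^sub>0\<close> times the product over \<open>C - {c\<^sub>0}\<close>: the scalar
  vanishes for \<open>c\<^sub>0\<close>, and for every other \<open>c\<close> the form is a
  factor.\<close>

lemma lagrange_der_in_log_der: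
  assumes ip: "interpolable c\<^sub>0 C T"
  shows "lagrange_der c\<^sub>0 C T \<in> log_der 3 (pencil_arr C T)"
  unfolding log_der_pencil_arr_iff
proof (intro conjI ballI)
  show "lagrange_der c\<^sub>0 C T \<in> Der 3" by (simp add: lagrange_der_def)
  fix c assume "c \<in> C"
  have "lagrange_der c\<^sub>0 C T x\<^sub>0 + poly_const c * lagrange_der c\<^sub>0 C T x\<^sub>1 =
      poly_const (c - c\<^sub>0) * pencil_prod (C - {c\<^sub>0})"
    by (simp add: poly_const_diff algebra_simps)
  moreover have "pencil_form c dvd pencil_prod (C - {c\<^sub>0})" if "c \<noteq> c\<^sub>0"
    using ip that \<open>c \<in> C\<close> by (simp add: pencil_form_dvd_pencil_prod_iff interpolable_def)
  ultimately show "pencil_form c dvd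
      lagrange_der c\<^sub>0 C T x\<^sub>0 + poly_const c * lagrange_der c\<^sub>0 C T x\<^sub>1"
    by (cases "c = c\<^sub>0") auto
next
  fix t assume "t \<in> T"
  have eq: "lagrange_der c\<^sub>0 C T x\<^sub>2 - poly_const t * lagrange_der c\<^sub>0 C T x\<^sub>0
      - poly_const (t\<^sup>2) * lagrange_der c\<^sub>0 C T x\<^sub>1 =
    lagrange_coeff c\<^sub>0 C T - poly_const (t * (t - c\<^sub>0)) * pencil_prod (C - {c\<^sub>0})"
    by (simp add: poly_const_diff poly_const_mult power2_eq_square algebra_simps)
  show "transversal_form t dvd lagrange_der c\<^sub>0 C T x\<^sub>2
      - poly_const t * lagrange_der c\<^sub>0 C T x\<^sub>0 - poly_const (t\<^sup>2) * lagrange_der c\<^sub>0 C T x\<^sub>1"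
    unfolding eq by (rule transversal_form_dvd_lagrange[OF ip \<open>t \<in> T\<close>])
qed

text \<open>The divisor from \<open>pencil_prod_dvd_minor\<close> is attained exactly. Subtracting a
  multiple of this derivation therefore clears the minor of any logarithmic derivation.\<close>

lemma lagrange_minor:
  assumes "interpolable c\<^sub>0 C T"
  shows "x\<^sub>0 * lagrange_der c\<^sub>0 C T x\<^sub>1 - x\<^sub>1 * lagrange_der c\<^sub>0 C T x\<^sub>0 = pencil_prod C"
proof -
  have "pencil_prod C = pencil_form c\<^sub>0 * pencil_prod (C - {c\<^sub>0})"
    using assms by (intro pencil_prod_remove) (simp_all add: interpolable_def)
  then show ?thesis by (simp add: pencil_form_def algebra_simps)
qed

definition vertical :: "'k::field set \<Rightarrow> 'k mpoly \<Rightarrow> 'k mpoly"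
  where "vertical T = der3 0 0 (transversal_prod T)"

lemma vertical_simps [simp]:
  "vertical T x\<^sub>0 = 0" "vertical T x\<^sub>1 = 0" "vertical T x\<^sub>2 = transversal_prod T"
  by (simp_all add: vertical_def)

lemma vertical_in_log_der: "finite T \<Longrightarrow> vertical T \<in> log_der 3 (pencil_arr C T)"
  unfolding log_der_pencil_arr_iff
  by (auto simp: vertical_def intro: transversal_form_dvd_transversal_prod)

lemma euler_simps [simp]: "euler x\<^sub>0 = x\<^sub>0" "euler x\<^sub>1 = x\<^sub>1" "euler x\<^sub>2 = x\<^sub>2"
  by (simp_all add: euler_def)

lemma Der_eqI_3:
  assumes "\<theta> \<in> Der 3" "\<eta> \<in> Der 3" "\<theta> x\<^sub>0 = \<eta> x\<^sub>0" "\<theta> x\<^sub>1 = \<eta> x\<^sub>1" "\<theta> x\<^sub>2 = \<eta> x\<^sub>2"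
  shows "\<theta> = \<eta>"
proof (rule Der_eqI[OF assms(1,2)])
  have "\<forall>i<3. \<theta> (poly_var i) = \<eta> (poly_var i)" using assms by (simp add: all_less_3)
  then show "i < 3 \<Longrightarrow> \<theta> (poly_var i) = \<eta> (poly_var i)" for i by blast
qed

lemma Der_combination_3:
  assumes "\<And>i. i \<in> {1..3} \<Longrightarrow> g i \<in> poly_ring 3" "\<theta>1 \<in> Der 3" "\<theta>2 \<in> Der 3" "\<theta>3 \<in> Der 3"
  shows "(\<lambda>f. g (1::nat) * \<theta>1 f + g 2 * \<theta>2 f + g 3 * \<theta>3 f) \<in> Der 3"
proof -
  define \<theta> where "\<theta> i = (if i = 1 then \<theta>1 else if i = 2 then \<theta>2 else \<theta>3)" for i :: nat
  have "(\<lambda>f. \<Sum>i=1..3. g i * \<theta> i f) \<in> Der 3"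
    using assms by (intro Der_combination) (auto simp: \<theta>_def)
  then show ?thesis unfolding sum_1_3 by (simp add: \<theta>_def)
qed

definition pencil_basis ::
  "'k::field \<Rightarrow> 'k set \<Rightarrow> 'k set \<Rightarrow> nat \<Rightarrow> 'k mpoly \<Rightarrow> 'k mpoly"
  where "pencil_basis c\<^sub>0 C T i =
    (if i = 1 then euler else if i = 2 then vertical T else lagrange_der c\<^sub>0 C T)"

lemma pencil_basis_in_log_der:
  assumes "interpolable c\<^sub>0 C T"
  shows "pencil_basis c\<^sub>0 C T i \<in> log_der 3 (pencil_arr C T)"
proof -
  have "finite T" using assms by (simp add: interpolable_def)
  then show ?thesis
    using lagrange_der_in_log_der[OF assms]
    by (simp add: pencil_basis_def euler_in_log_der vertical_in_log_der)
qed

text \<open>Existence: clear the minor with the third element, then split the rest into its Euler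
  and vertical parts. Uniqueness: the minor kills \<open>euler\<close> and \<open>vertical T\<close>
  and so determines the third coefficient; the values on \<open>x\<^sub>0\<close> and
  \<open>x\<^sub>2\<close> then determine the other two.\<close>

lemma log_der_basis_pencil_arr:
  assumes ip: "interpolable c\<^sub>0 C T"
  shows "log_der_basis 3 (pencil_arr C T) (pencil_basis c\<^sub>0 C T)"
  unfolding log_der_basis_def
proof (intro conjI ballI)
  let ?\<psi> = "lagrange_der c\<^sub>0 C T"
  have fin: "finite C" "finite T" using ip by (simp_all add: interpolable_def)
  have in_Der: "pencil_basis c\<^sub>0 C T i \<in> Der 3" for i
    using pencil_basis_in_log_der[OF ip] by (rule log_der_Der)
  have Ders: "(euler :: 'a mpoly \<Rightarrow> _) \<in> Der 3" "vertical T \<in> Der 3" "?\<psi> \<in> Der 3"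
    using in_Der[of 1] in_Der[of 2] in_Der[of 3] by (simp_all add: pencil_basis_def)
  have expand: "(\<Sum>i=1..3. g i * pencil_basis c\<^sub>0 C T i f) =
      g 1 * euler f + g 2 * vertical T f + g 3 * ?\<psi> f" for g f
    unfolding sum_1_3 by (simp add: pencil_basis_def)
  show "pencil_basis c\<^sub>0 C T i \<in> log_der 3 (pencil_arr C T)" for i
    by (rule pencil_basis_in_log_der[OF ip])
  fix \<eta> assume \<eta>: "\<eta> \<in> log_der 3 (pencil_arr C T)"
  have \<eta>_Der: "\<eta> \<in> Der 3" using \<eta> by (rule log_der_Der)
  show "\<exists>!g. g \<in> {1..3} \<rightarrow>\<^sub>E poly_ring 3 \<and>
      \<eta> = (\<lambda>f. \<Sum>i=1..3. g i * pencil_basis c\<^sub>0 C T i f)"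
  proof (rule ex_ex1I)
    obtain q where q: "x\<^sub>0 * \<eta> x\<^sub>1 - x\<^sub>1 * \<eta> x\<^sub>0 = pencil_prod C * q"
      using pencil_prod_dvd_minor[OF \<eta> fin(1)] by (elim dvdE)
    have "x\<^sub>0 * \<eta> x\<^sub>1 - x\<^sub>1 * \<eta> x\<^sub>0 \<in> poly_ring 3" using Der_in_3[OF \<eta>_Der] by simp
    then have qr: "q \<in> poly_ring 3"
      unfolding q by (rule poly_ring_cofactor) simp_all
    define \<zeta> where "\<zeta> = (\<lambda>f. \<eta> f - q * ?\<psi> f)"
    have \<zeta>_Der: "\<zeta> \<in> Der 3"
    proof -
      define g :: "nat \<Rightarrow> 'a mpoly" where "g i = (if i = 1 then 1 else if i = 2 then 0 else - q)" for i
      have "(\<lambda>f. g 1 * \<eta> f + g 2 * \<eta> f + g 3 * ?\<psi> f) \<in> Der 3"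
        by (rule Der_combination_3) (use \<eta>_Der Ders qr in \<open>auto simp: g_def\<close>)
      then show ?thesis by (simp add: g_def \<zeta>_def)
    qed
    have \<zeta>: "\<zeta> \<in> log_der 3 (pencil_arr C T)"
      unfolding log_der_pencil_arr_iff
    proof (intro conjI ballI \<zeta>_Der)
      fix c assume c: "c \<in> C"
      have "\<zeta> x\<^sub>0 + poly_const c * \<zeta> x\<^sub>1 =
          (\<eta> x\<^sub>0 + poly_const c * \<eta> x\<^sub>1) - q * (?\<psi> x\<^sub>0 + poly_const c * ?\<psi> x\<^sub>1)"
        by (simp add: \<zeta>_def algebra_simps)
      moreover have "pencil_form c dvd \<dots>"
        using \<eta> lagrange_der_in_log_der[OF ip] c unfolding log_der_pencil_arr_iff
        by (intro dvd_diff[OF _ dvd_mult]) blast+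
      ultimately show "pencil_form c dvd \<zeta> x\<^sub>0 + poly_const c * \<zeta> x\<^sub>1" by (simp only:)
    next
      fix t assume t: "t \<in> T"
      have "\<zeta> x\<^sub>2 - poly_const t * \<zeta> x\<^sub>0 - poly_const (t\<^sup>2) * \<zeta> x\<^sub>1 =
          (\<eta> x\<^sub>2 - poly_const t * \<eta> x\<^sub>0 - poly_const (t\<^sup>2) * \<eta> x\<^sub>1)
          - q * (?\<psi> x\<^sub>2 - poly_const t * ?\<psi> x\<^sub>0 - poly_const (t\<^sup>2) * ?\<psi> x\<^sub>1)"
        by (simp add: \<zeta>_def algebra_simps)
      moreover have "transversal_form t dvd \<dots>"
        using \<eta> lagrange_der_in_log_der[OF ip] t unfolding log_der_pencil_arr_iff
        by (intro dvd_diff[OF _ dvd_mult, of _ "\<eta> x\<^sub>2 - _ - _"]) blast+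
      ultimately show "transversal_form t dvd
        \<zeta> x\<^sub>2 - poly_const t * \<zeta> x\<^sub>0 - poly_const (t\<^sup>2) * \<zeta> x\<^sub>1" by (simp only:)
    qed
    have "x\<^sub>0 * \<zeta> x\<^sub>1 - x\<^sub>1 * \<zeta> x\<^sub>0 = (x\<^sub>0 * \<eta> x\<^sub>1 - x\<^sub>1 * \<eta> x\<^sub>0) - q * (x\<^sub>0 * ?\<psi> x\<^sub>1 - x\<^sub>1 * ?\<psi> x\<^sub>0)"
      unfolding \<zeta>_def by algebra
    also have "\<dots> = 0" unfolding q lagrange_minor[OF ip] by simp
    finally have "x\<^sub>0 * \<zeta> x\<^sub>1 = x\<^sub>1 * \<zeta> x\<^sub>0" by simp
    then obtain e r where er: "e \<in> poly_ring 3" "r \<in> poly_ring 3" "\<zeta> x\<^sub>0 = e * x\<^sub>0" "\<zeta> x\<^sub>1 = e * x\<^sub>1"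
        "\<zeta> x\<^sub>2 = e * x\<^sub>2 + r * transversal_prod T"
      using zero_minor_decomposition[OF \<zeta> fin(2)] by metis
    define g :: "nat \<Rightarrow> 'a mpoly" where "g = (\<lambda>i\<in>{1..3}. if i = 1 then e else if i = 2 then r else q)"
    have g: "g 1 = e" "g 2 = r" "g 3 = q" by (simp_all add: g_def)
    have \<eta>_eq: "\<eta> f = \<zeta> f + q * ?\<psi> f" for f by (simp add: \<zeta>_def)
    have "\<eta> = (\<lambda>f. g 1 * euler f + g 2 * vertical T f + g 3 * ?\<psi> f)"
    proof (rule Der_eqI_3[OF \<eta>_Der])
      show "(\<lambda>f. g 1 * euler f + g 2 * vertical T f + g 3 * ?\<psi> f) \<in> Der 3"
        by (rule Der_combination_3) (use er qr Ders in \<open>auto simp: g_def\<close>)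
    qed (simp_all only: g \<eta>_eq er(3-5) euler_simps vertical_simps mult_zero_right add_0_right)
    moreover have "g \<in> {1..3} \<rightarrow>\<^sub>E poly_ring 3" using er qr by (auto simp: g_def)
    ultimately show "\<exists>g. g \<in> {1..3} \<rightarrow>\<^sub>E poly_ring 3 \<and>
        \<eta> = (\<lambda>f. \<Sum>i=1..3. g i * pencil_basis c\<^sub>0 C T i f)"
      unfolding expand by blast
  next
    fix g g' assume
      "g \<in> {1..3} \<rightarrow>\<^sub>E poly_ring 3 \<and> \<eta> = (\<lambda>f. \<Sum>i=1..3. g i * pencil_basis c\<^sub>0 C T i f)"
      "g' \<in> {1..3} \<rightarrow>\<^sub>E poly_ring 3 \<and> \<eta> = (\<lambda>f. \<Sum>i=1..3. g' i * pencil_basis c\<^sub>0 C T i f)"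
    then have ext: "g \<in> {1..3} \<rightarrow>\<^sub>E poly_ring 3" "g' \<in> {1..3} \<rightarrow>\<^sub>E poly_ring 3"
      and eq: "\<And>f. g 1 * euler f + g 2 * vertical T f + g 3 * ?\<psi> f =
          g' 1 * euler f + g' 2 * vertical T f + g' 3 * ?\<psi> f"
      unfolding expand by (metis (no_types, lifting))+
    define h where "h i = g i - g' i" for i
    have heq: "h 1 * euler f + h 2 * vertical T f + h 3 * ?\<psi> f = 0" for f
      using eq[of f] by (simp add: h_def algebra_simps)
    have h0: "h 1 * x\<^sub>0 + h 3 * ?\<psi> x\<^sub>0 = 0" and h1: "h 1 * x\<^sub>1 + h 3 * ?\<psi> x\<^sub>1 = 0"
      and h2: "h 1 * x\<^sub>2 + h 2 * transversal_prod T + h 3 * ?\<psi> x\<^sub>2 = 0"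
      using heq[of "x\<^sub>0"] heq[of "x\<^sub>1"] heq[of "x\<^sub>2"] by (simp_all del: lagrange_der_simps)
    have "h 3 * (x\<^sub>0 * ?\<psi> x\<^sub>1 - x\<^sub>1 * ?\<psi> x\<^sub>0) = 0" using h0 h1 by algebra
    then have "h 3 = 0" unfolding lagrange_minor[OF ip] by simp
    moreover from this have "h 1 = 0" using h0 by simp
    ultimately have "h 2 = 0" using h2 by simp
    then have "g i = g' i" if "i \<in> {1..3}" for i
      using \<open>h 1 = 0\<close> \<open>h 3 = 0\<close> that unfolding atLeastAtMost_1_3 by (auto simp: h_def)
    then show "g = g'" using ext by (intro PiE_ext) auto
  qed
qed

definition pencil_exponents :: "nat \<Rightarrow> nat \<Rightarrow> nat \<Rightarrow> nat"
  where "pencil_exponents m k i = (if i = 1 then 1 else if i = 2 then k else m - 1)"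

text \<open>Each interpolation term trades the \<open>card T - 1\<close> members
  \<open>t + s\<close> of the pencil for as many transversals, which keeps the degree at
  \<open>card C - 1\<close>. The cardinality conditions put the three degrees in increasing
  order.\<close>

lemma exponents_pencil_arr:
  assumes ip: "interpolable c\<^sub>0 C T" and card: "1 \<le> card T" "card T < card C"
  shows "exponents 3 (pencil_arr C T) (pencil_exponents (card C) (card T))"
proof -
  let ?d = "pencil_exponents (card C) (card T)"
  have fin: "finite C" "finite T" "c\<^sub>0 \<in> C" using ip by (simp_all add: interpolable_def)
  have "homogeneous (card C - 1) (pencil_prod (C - {c\<^sub>0}))"
    using homogeneous_pencil_prod[of "C - {c\<^sub>0}"] fin by simp
  moreover have "homogeneous (card C - 1) (lagrange_coeff c\<^sub>0 C T)"
    unfolding lagrange_coeff_def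
  proof (rule homogeneous_sum)
    fix t assume t: "t \<in> T"
    let ?D = "(+) t ` (T - {t})"
    have sub: "?D \<subseteq> C - {c\<^sub>0}" using ip t by (auto simp: interpolable_def)
    have cD: "card ?D = card T - 1" using fin t by (simp add: card_image)
    have cCD: "card (C - {c\<^sub>0} - ?D) = card C - 1 - (card T - 1)"
      using card_Diff_subset[OF _ sub] fin cD by simp
    have "homogeneous (card C - 1 - (card T - 1)) (pencil_prod (C - {c\<^sub>0} - ?D))"
      using homogeneous_pencil_prod[of "C - {c\<^sub>0} - ?D"] by (simp only: cCD)
    moreover have "homogeneous (card T - 1) (transversal_prod (T - {t}))"
      using homogeneous_transversal_prod[of "T - {t}"] fin t by simp
    ultimately show "homogeneous (card C - 1)
      (poly_const (t * (t - c\<^sub>0) / (\<Prod>s\<in>T - {t}. t - s)) * pencil_prod (C - {c\<^sub>0} - ?D) *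
        transversal_prod (T - {t}))"
      using card
      by (intro homogeneous_mult[of "card C - 1 - (card T - 1)" _ "card T - 1"]
          homogeneous_const_mult) auto
  qed
  ultimately have "homogeneous_der 3 (?d i) (pencil_basis c\<^sub>0 C T i)" for i
    using homogeneous_transversal_prod[of T]
    by (simp add: homogeneous_der_3 pencil_exponents_def pencil_basis_def)
  moreover have "mono_on {1..3} ?d"
    using card unfolding atLeastAtMost_1_3 by (auto simp: mono_on_def pencil_exponents_def)
  ultimately show ?thesis
    using log_der_basis_pencil_arr[OF ip] unfolding exponents_def by blast
qed

subsection \<open>Bounds on exponents\<close>

definition det3 :: "(nat \<Rightarrow> 'k::field mpoly \<Rightarrow> 'k mpoly) \<Rightarrow> 'k mpoly"
  where "det3 \<theta> =
    \<theta> 1 x\<^sub>0 * (\<theta> 2 x\<^sub>1 * \<theta> 3 x\<^sub>2 - \<theta> 2 x\<^sub>2 * \<theta> 3 x\<^sub>1)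
    - \<theta> 1 x\<^sub>1 * (\<theta> 2 x\<^sub>0 * \<theta> 3 x\<^sub>2 - \<theta> 2 x\<^sub>2 * \<theta> 3 x\<^sub>0)
    + \<theta> 1 x\<^sub>2 * (\<theta> 2 x\<^sub>0 * \<theta> 3 x\<^sub>1 - \<theta> 2 x\<^sub>1 * \<theta> 3 x\<^sub>0)"

lemma homogeneous_det3:
  assumes "\<And>i. i \<in> {1..3} \<Longrightarrow> homogeneous_der 3 (d i) (\<theta> i)"
  shows "homogeneous (d 1 + d 2 + d 3) (det3 \<theta>)"
proof -
  have "homogeneous_der 3 (d 1) (\<theta> 1)" "homogeneous_der 3 (d 2) (\<theta> 2)" "homogeneous_der 3 (d 3) (\<theta> 3)"
    using assms by simp_all
  then have "homogeneous (d 1 + (d 2 + d 3)) (det3 \<theta>)"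
    unfolding det3_def homogeneous_der_3
    by (intro homogeneous_add homogeneous_diff homogeneous_mult[OF _ _ refl]) simp_all
  then show ?thesis by (simp only: add.assoc)
qed

text \<open>Every matrix of logarithmic derivations factors through the basis.\<close>

lemma det3_basis_dvd:
  assumes basis: "log_der_basis 3 A \<theta>" and \<eta>: "\<And>i. i \<in> {1..3} \<Longrightarrow> \<eta> i \<in> log_der 3 A"
  shows "det3 \<theta> dvd det3 \<eta>"
proof -
  have "\<exists>a b c. \<forall>f. \<eta> i f = a * \<theta> 1 f + b * \<theta> 2 f + c * \<theta> 3 f" if i: "i \<in> {1..3}" for i
    using log_der_basis_exists[OF basis \<eta>[OF i]] unfolding sum_1_3 by blast
  then obtain a b c where eq: "\<And>i f. i \<in> {1..3} \<Longrightarrow> \<eta> i f = a i * \<theta> 1 f + b i * \<theta> 2 f + c i * \<theta> 3 f"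
    by metis
  have eqs: "\<eta> 1 f = a 1 * \<theta> 1 f + b 1 * \<theta> 2 f + c 1 * \<theta> 3 f"
    "\<eta> 2 f = a 2 * \<theta> 1 f + b 2 * \<theta> 2 f + c 2 * \<theta> 3 f"
    "\<eta> 3 f = a 3 * \<theta> 1 f + b 3 * \<theta> 2 f + c 3 * \<theta> 3 f" for f
    using eq by simp_all
  have "det3 \<eta> = det3 \<theta> * (a 1 * (b 2 * c 3 - b 3 * c 2) - b 1 * (a 2 * c 3 - a 3 * c 2)
      + c 1 * (a 2 * b 3 - a 3 * b 2))"
    unfolding det3_def eqs by (simp add: algebra_simps)
  then show ?thesis by simp
qed

text \<open>With Q the product of all forms, the three derivations Q d/dx_i are logarithmic and have
  determinant Q^3. Consequently the determinant of a basis is nonzero and has no prime factor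
  outside the arrangement.\<close>

lemma det3_basis_dvd_cube:
  assumes basis: "log_der_basis 3 (pencil_arr C T) \<theta>" and fin: "finite C" "finite T"
  shows "det3 \<theta> dvd (pencil_prod C * transversal_prod T) ^ 3"
proof -
  let ?Q = "pencil_prod C * transversal_prod T"
  define \<eta> where "\<eta> i = der3 (if i = 1 then ?Q else 0) (if i = 2 then ?Q else 0) (if i = 3 then ?Q else 0)"
    for i :: nat
  have "\<eta> i \<in> log_der 3 (pencil_arr C T)" for i
    unfolding log_der_pencil_arr_iff \<eta>_def
    using transversal_form_dvd_transversal_prod[OF fin(2)] pencil_form_dvd_pencil_prod_iff[OF fin(1)]
    by (auto simp: dvd_mult dvd_mult2)
  then have "det3 \<theta> dvd det3 \<eta>" by (intro det3_basis_dvd[OF basis])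
  also have "det3 \<eta> = ?Q ^ 3" by (simp add: det3_def \<eta>_def power3_eq_cube mult.assoc)
  finally show ?thesis .
qed

lemma det3_basis_neq_0:
  assumes "log_der_basis 3 (pencil_arr C T) \<theta>" "finite C" "finite T"
  shows "det3 \<theta> \<noteq> 0"
  using det3_basis_dvd_cube[OF assms] by auto

text \<open>Euclid's lemma, one prime at a time: a form that divides \<open>p * g\<close> but not
  \<open>p\<close> divides \<open>g\<close> and can be cancelled.\<close>

lemma dvd_cancel_pencil_prod:
  assumes "finite D" "\<And>c. c \<in> D \<Longrightarrow> \<not> pencil_form c dvd p" "p dvd f * pencil_prod D"
  shows "p dvd f"
  using assms
proof (induction D rule: finite_induct)
  case (insert c D)
  then obtain g where g: "f * pencil_prod (insert c D) = p * g" by (auto elim: dvdE)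
  have ins: "pencil_prod (insert c D) = pencil_form c * pencil_prod D"
    using insert.hyps by (simp add: pencil_prod_def)
  then have "pencil_form c dvd p * g" unfolding g[symmetric] by simp
  then have "pencil_form c dvd g" using insert.prems(1)[of c] by (simp add: pencil_form_dvd_mult_iff)
  then obtain h where "g = pencil_form c * h" by (elim dvdE)
  then have "pencil_form c * (f * pencil_prod D) = pencil_form c * (p * h)"
    using g ins by (simp add: mult_ac)
  then have "f * pencil_prod D = p * h" by simp
  then show ?case using insert.IH insert.prems(1) by simp
qed (simp add: pencil_prod_def)

text \<open>Saito's criterion in the form needed here: the determinant of a basis divides the product of
  all forms of a larger arrangement, but is prime to those outside the smaller one.\<close>

lemma sum_exponents_le:
  assumes ip: "interpolable c\<^sub>0 C T" and "C' \<subseteq> C" and exp: "exponents 3 (pencil_arr C' T) d"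
  shows "d 1 + d 2 + d 3 \<le> card C' + card T"
proof -
  have fin: "finite C" "finite T" "finite C'"
    using ip \<open>C' \<subseteq> C\<close> finite_subset by (auto simp: interpolable_def)
  obtain \<theta> where basis: "log_der_basis 3 (pencil_arr C' T) \<theta>"
    and hom: "\<And>i. i \<in> {1..3} \<Longrightarrow> homogeneous_der 3 (d i) (\<theta> i)"
    using exp by (auto simp: exponents_def)
  \<comment> \<open>Enlarging the arrangement shrinks the module. The explicit basis for
    \<open>C\<close> thus serves for comparison even when \<open>C'\<close> lacks a sum and admits
    no interpolation.\<close>
  have "pencil_basis c\<^sub>0 C T i \<in> log_der 3 (pencil_arr C' T)" for i
    using pencil_basis_in_log_der[OF ip, of i] \<open>C' \<subseteq> C\<close> unfolding log_der_pencil_arr_iff by blast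
  then have "det3 \<theta> dvd det3 (pencil_basis c\<^sub>0 C T)" by (intro det3_basis_dvd[OF basis])
  also have "det3 (pencil_basis c\<^sub>0 C T) = - (transversal_prod T *
      (x\<^sub>0 * lagrange_der c\<^sub>0 C T x\<^sub>1 - x\<^sub>1 * lagrange_der c\<^sub>0 C T x\<^sub>0))"
    by (simp add: det3_def pencil_basis_def algebra_simps del: lagrange_der_simps)
  also have "\<dots> = - (transversal_prod T * pencil_prod C)" by (simp only: lagrange_minor[OF ip])
  also have "pencil_prod C = pencil_prod C' * pencil_prod (C - C')"
    unfolding pencil_prod_def using prod.subset_diff[OF \<open>C' \<subseteq> C\<close> fin(1)] by (simp add: mult.commute)
  finally have dvd: "det3 \<theta> dvd (transversal_prod T * pencil_prod C') * pencil_prod (C - C')"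
    by (simp add: mult.assoc)
  have "\<not> pencil_form c dvd det3 \<theta>" if "c \<in> C - C'" for c
  proof
    assume "pencil_form c dvd det3 \<theta>"
    then have "pencil_form c dvd (pencil_prod C' * transversal_prod T) ^ 3"
      using det3_basis_dvd_cube[OF basis fin(3,2)] by (rule dvd_trans)
    then show False
      using that fin
      by (simp add: power3_eq_cube pencil_form_dvd_mult_iff pencil_form_dvd_pencil_prod_iff
          pencil_form_not_dvd_transversal_prod)
  qed
  then have dvd': "det3 \<theta> dvd transversal_prod T * pencil_prod C'"
    using fin(1) by (intro dvd_cancel_pencil_prod[OF _ _ dvd]) simp_all
  have hom_prod: "homogeneous (card C' + card T) (transversal_prod T * pencil_prod C')"
    by (rule homogeneous_mult[OF homogeneous_transversal_prod homogeneous_pencil_prod]) simp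
  show ?thesis
  proof (rule ccontr)
    assume "\<not> ?thesis"
    then have "transversal_prod T * pencil_prod C' = 0"
      using homogeneous_eq_zero[OF hom_prod homogeneous_det3[of d \<theta>, OF hom] dvd'] by simp
    then show False by simp
  qed
qed

lemma minor_eq_0:
  assumes "\<eta> \<in> log_der 3 (pencil_arr C T)" "finite C"
    and "homogeneous_der 3 n \<eta>" "n + 1 < card C"
  shows "x\<^sub>0 * \<eta> x\<^sub>1 = x\<^sub>1 * \<eta> x\<^sub>0"
proof -
  have "homogeneous (n + 1) (x\<^sub>0 * \<eta> x\<^sub>1 - x\<^sub>1 * \<eta> x\<^sub>0)"
    using assms(3) unfolding homogeneous_der_3
    by (intro homogeneous_diff homogeneous_mult[of "Suc 0" _ n]) simp_all
  then have "x\<^sub>0 * \<eta> x\<^sub>1 - x\<^sub>1 * \<eta> x\<^sub>0 = 0"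
    using homogeneous_pencil_prod pencil_prod_dvd_minor[OF assms(1,2)] assms(4)
    by (rule homogeneous_eq_zero)
  then show ?thesis by simp
qed

text \<open>The first minor vanishes by degree, leaving \<open>e\<close> times Euler plus
  \<open>r\<close> times the vertical derivation. The minor in coordinates 0 and 2 is then
  \<open>r * x\<^sub>0 * transversal_prod T\<close> and again of too low a degree. Working with
  minors avoids proving \<open>e\<close> and \<open>r\<close> homogeneous.\<close>

lemma low_degree_multiple_of_euler:
  assumes \<eta>: "\<eta> \<in> log_der 3 (pencil_arr C T)" and fin: "finite C" "finite T"
    and hom: "homogeneous_der 3 n \<eta>" and n: "n + 1 < card C" "n < card T"
  obtains e where "\<eta> x\<^sub>0 = e * x\<^sub>0" "\<eta> x\<^sub>1 = e * x\<^sub>1" "\<eta> x\<^sub>2 = e * x\<^sub>2"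
proof -
  obtain e r where er: "\<eta> x\<^sub>0 = e * x\<^sub>0" "\<eta> x\<^sub>1 = e * x\<^sub>1" "\<eta> x\<^sub>2 = e * x\<^sub>2 + r * transversal_prod T"
    using zero_minor_decomposition[OF \<eta> fin(2) minor_eq_0[OF \<eta> fin(1) hom n(1)]] by metis
  have "x\<^sub>0 * \<eta> x\<^sub>2 - x\<^sub>2 * \<eta> x\<^sub>0 = (x\<^sub>0 * transversal_prod T) * r"
    unfolding er by (simp add: algebra_simps)
  then have "x\<^sub>0 * transversal_prod T dvd x\<^sub>0 * \<eta> x\<^sub>2 - x\<^sub>2 * \<eta> x\<^sub>0" by simp
  moreover have "homogeneous (n + 1) (x\<^sub>0 * \<eta> x\<^sub>2 - x\<^sub>2 * \<eta> x\<^sub>0)"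
    using hom unfolding homogeneous_der_3
    by (intro homogeneous_diff homogeneous_mult[of "Suc 0" _ n]) simp_all
  moreover have "homogeneous (1 + card T) (x\<^sub>0 * transversal_prod T)"
    by (rule homogeneous_mult[OF homogeneous_var homogeneous_transversal_prod]) simp
  ultimately have "x\<^sub>0 * \<eta> x\<^sub>2 - x\<^sub>2 * \<eta> x\<^sub>0 = 0"
    using n(2) by (metis homogeneous_eq_zero add.commute add_less_cancel_left)
  then have "x\<^sub>0 * \<eta> x\<^sub>2 = x\<^sub>0 * (e * x\<^sub>2)" by (simp add: er algebra_simps)
  then have "\<eta> x\<^sub>2 = e * x\<^sub>2" by (metis mult_left_cancel poly_var_neq_0)
  then show ?thesis using that er by blast
qed

text \<open>Each failing bound makes the determinant of the basis zero: the first makes two columns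
  proportional, the second makes two rows multiples of \<open>euler\<close>, the third makes a row
  vanish.\<close>

lemma exponents_lower_bounds:
  assumes exp: "exponents 3 (pencil_arr C T) d" and fin: "finite C" "finite T"
  shows "card C \<le> d 3 + 1"
    and "card C \<le> d 2 + 1 \<or> card T \<le> d 2"
    and "2 \<le> card C \<Longrightarrow> 1 \<le> card T \<Longrightarrow> 1 \<le> d 1"
proof -
  obtain \<theta> where basis: "log_der_basis 3 (pencil_arr C T) \<theta>"
    and hom: "\<And>i. i \<in> {1..3} \<Longrightarrow> homogeneous_der 3 (d i) (\<theta> i)"
    and mono: "mono_on {1..3} d"
    using exp by (auto simp: exponents_def)
  have mem: "\<theta> i \<in> log_der 3 (pencil_arr C T)" if "i \<in> {1..3}" for i
    using log_der_basis_mem[OF basis that] .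
  have det: "det3 \<theta> \<noteq> 0" using det3_basis_neq_0[OF basis fin] .
  have le: "d i \<le> d j" if "i \<in> {1..3}" "j \<in> {1..3}" "i \<le> j" for i j
    using mono_onD[OF mono that] .
  show "card C \<le> d 3 + 1"
  proof (rule ccontr)
    assume neg: "\<not> card C \<le> d 3 + 1"
    have "x\<^sub>0 * \<theta> i x\<^sub>1 = x\<^sub>1 * \<theta> i x\<^sub>0" if i: "i \<in> {1..3}" for i
      using le[OF i, of 3] i neg by (intro minor_eq_0[OF mem[OF i] fin(1) hom[OF i]]) simp
    then have minors: "x\<^sub>0 * \<theta> 1 x\<^sub>1 = x\<^sub>1 * \<theta> 1 x\<^sub>0" "x\<^sub>0 * \<theta> 2 x\<^sub>1 = x\<^sub>1 * \<theta> 2 x\<^sub>0" "x\<^sub>0 * \<theta> 3 x\<^sub>1 = x\<^sub>1 * \<theta> 3 x\<^sub>0"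
      by simp_all
    \<comment> \<open>The factor \<open>x\<^sub>0\<close> allows every entry of the second column to
      be replaced by \<open>x\<^sub>1\<close> times the corresponding entry of the first.\<close>
    have "x\<^sub>0 * det3 \<theta> = \<theta> 1 x\<^sub>0 * ((x\<^sub>0 * \<theta> 2 x\<^sub>1) * \<theta> 3 x\<^sub>2 - \<theta> 2 x\<^sub>2 * (x\<^sub>0 * \<theta> 3 x\<^sub>1))
        - (x\<^sub>0 * \<theta> 1 x\<^sub>1) * (\<theta> 2 x\<^sub>0 * \<theta> 3 x\<^sub>2 - \<theta> 2 x\<^sub>2 * \<theta> 3 x\<^sub>0)
        + \<theta> 1 x\<^sub>2 * (\<theta> 2 x\<^sub>0 * (x\<^sub>0 * \<theta> 3 x\<^sub>1) - (x\<^sub>0 * \<theta> 2 x\<^sub>1) * \<theta> 3 x\<^sub>0)"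
      unfolding det3_def by (simp add: algebra_simps)
    also have "\<dots> = 0" unfolding minors by (simp add: algebra_simps)
    finally show False using det by simp
  qed
  show "card C \<le> d 2 + 1 \<or> card T \<le> d 2"
  proof (rule ccontr)
    assume neg: "\<not> ?thesis"
    have "\<exists>e. \<theta> i x\<^sub>0 = e * x\<^sub>0 \<and> \<theta> i x\<^sub>1 = e * x\<^sub>1 \<and> \<theta> i x\<^sub>2 = e * x\<^sub>2" if "i \<in> {1, 2}" for i
    proof -
      have i: "i \<in> {1..3}" using that by auto
      have "d i \<le> d 2" using le[OF i, of 2] that by auto
      then show ?thesis
        using low_degree_multiple_of_euler[OF mem[OF i] fin hom[OF i]] neg by force
    qed
    then obtain e e' where
      "\<theta> 1 x\<^sub>0 = e * x\<^sub>0" "\<theta> 1 x\<^sub>1 = e * x\<^sub>1" "\<theta> 1 x\<^sub>2 = e * x\<^sub>2"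
      "\<theta> 2 x\<^sub>0 = e' * x\<^sub>0" "\<theta> 2 x\<^sub>1 = e' * x\<^sub>1" "\<theta> 2 x\<^sub>2 = e' * x\<^sub>2"
      by (metis insertI1 insertI2)
    then have "det3 \<theta> = 0" unfolding det3_def by (simp only:) (simp add: algebra_simps)
    then show False using det by simp
  qed
  show "1 \<le> d 1" if card: "2 \<le> card C" "1 \<le> card T"
  proof (rule ccontr)
    assume "\<not> 1 \<le> d 1"
    then have d1: "d 1 = 0" by simp
    have hom1: "homogeneous_der 3 0 (\<theta> 1)" using hom[of 1] d1 by simp
    obtain e where e: "\<theta> 1 x\<^sub>0 = e * x\<^sub>0" "\<theta> 1 x\<^sub>1 = e * x\<^sub>1" "\<theta> 1 x\<^sub>2 = e * x\<^sub>2"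
      using low_degree_multiple_of_euler[OF mem fin hom1] card by auto
    have "\<theta> 1 x\<^sub>0 = 0"
    proof (rule homogeneous_eq_zero[of 0 _ "Suc 0" "x\<^sub>0"])
      show "homogeneous 0 (\<theta> 1 x\<^sub>0)" using hom1 unfolding homogeneous_der_3 by blast
      show "x\<^sub>0 dvd \<theta> 1 x\<^sub>0" unfolding e by (rule dvd_triv_right)
    qed simp_all
    then have "e = 0" unfolding e by simp
    then have "det3 \<theta> = 0" unfolding det3_def e by simp
    then show False using det by simp
  qed
qed

subsection \<open>Intersections and restrictions\<close>

definition axis :: "'k::field kvec set"
  where "axis = {v \<in> coord_space 3. v 0 = 0 \<and> v 1 = 0}"

definition ray :: "'k \<Rightarrow> 'k \<Rightarrow> 'k::field kvec set"
  where "ray c w = {v \<in> coord_space 3. v 0 = - (c * v 1) \<and> v 2 = w * v 1}"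

lemma mem_pencil: "v \<in> pencil c \<longleftrightarrow> v \<in> coord_space 3 \<and> v 0 = - (c * v 1)"
  by (simp add: pencil_def form_kernel_iff sum_lessThan_3 eq_neg_iff_add_eq_0)

lemma mem_transversal:
  "v \<in> transversal t \<longleftrightarrow> v \<in> coord_space 3 \<and> v 2 = t * v 0 + t\<^sup>2 * v 1"
proof -
  have "- (t * v 0) - t\<^sup>2 * v 1 + v 2 = 0 \<longleftrightarrow> v 2 = t * v 0 + t\<^sup>2 * v 1"
    by (auto simp: algebra_simps)
  then show ?thesis by (simp add: transversal_def form_kernel_iff sum_lessThan_3)
qed

lemma pencil_Int_pencil: "c \<noteq> c' \<Longrightarrow> pencil c \<inter> pencil c' = axis"
  by (auto simp: mem_pencil axis_def)

text \<open>The second parameter of \<open>ray\<close> is the height at which \<open>t\<close>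
  crosses the member \<open>c\<close>. As
  \<open>s * (s - c) - t * (t - c) = (s - t) * (s + t - c)\<close>, distinct transversals share a
  height exactly when they sum to \<open>c\<close>.\<close>

lemma pencil_Int_transversal: "pencil c \<inter> transversal t = ray c (t * (t - c))"
  by (auto simp: mem_pencil mem_transversal ray_def power2_eq_square algebra_simps)

lemma transversal_Int_transversal:
  assumes "s \<noteq> t"
  shows "transversal s \<inter> transversal t = transversal s \<inter> pencil (s + t)"
proof -
  have "s * a + s\<^sup>2 * b = t * a + t\<^sup>2 * b \<longleftrightarrow> a = - ((s + t) * b)" for a b :: 'a
  proof -
    have "s * a + s\<^sup>2 * b - (t * a + t\<^sup>2 * b) = (s - t) * (a + (s + t) * b)"
      by (simp add: algebra_simps power2_eq_square)
    then have "s * a + s\<^sup>2 * b = t * a + t\<^sup>2 * b \<longleftrightarrow> a + (s + t) * b = 0"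
      using assms by (metis eq_iff_diff_eq_0 mult_eq_0_iff)
    then show ?thesis by (simp add: eq_neg_iff_add_eq_0)
  qed
  then have "v 2 = s * v 0 + s\<^sup>2 * v 1 \<and> v 2 = t * v 0 + t\<^sup>2 * v 1 \<longleftrightarrow>
      v 2 = s * v 0 + s\<^sup>2 * v 1 \<and> v 0 = - ((s + t) * v 1)" for v :: "'a kvec"
    by metis
  then show ?thesis unfolding set_eq_iff Int_iff mem_transversal mem_pencil by blast
qed

lemma ray_eq_iff [simp]: "ray c w = ray c' w' \<longleftrightarrow> c = c' \<and> w = w'"
proof
  assume "ray c w = ray c' w'"
  moreover have "vec3 (- c) 1 w \<in> ray c w" by (simp add: ray_def)
  ultimately have "vec3 (- c) 1 w \<in> ray c' w'" by simp
  then show "c = c' \<and> w = w'" by (simp add: ray_def)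
qed simp

lemma axis_neq_ray [simp]: "axis \<noteq> ray c w"
proof -
  have "vec3 0 0 1 \<in> axis" "vec3 0 0 1 \<notin> ray c w" by (simp_all add: axis_def ray_def)
  then show ?thesis by blast
qed

lemma pencil_eq_iff [simp]: "pencil c = pencil c' \<longleftrightarrow> c = c'"
proof
  assume "pencil c = pencil c'"
  moreover have "vec3 (- c) 1 0 \<in> pencil c" by (simp add: mem_pencil)
  ultimately have "vec3 (- c) 1 0 \<in> pencil c'" by simp
  then show "c = c'" by (simp add: mem_pencil)
qed simp

lemma pencil_neq_transversal [simp]: "pencil c \<noteq> transversal t" "transversal t \<noteq> pencil c"
proof -
  have "vec3 0 0 1 \<in> pencil c" "vec3 0 0 1 \<notin> transversal t"
    by (simp_all add: mem_pencil mem_transversal)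
  then show "pencil c \<noteq> transversal t" "transversal t \<noteq> pencil c" by blast+
qed

lemma transversal_eq_iff [simp]: "transversal s = transversal t \<longleftrightarrow> s = t"
proof
  assume "transversal s = transversal t"
  moreover have "vec3 1 0 s \<in> transversal s" by (simp add: mem_transversal)
  ultimately have "vec3 1 0 s \<in> transversal t" by simp
  then show "s = t" by (simp add: mem_transversal)
qed simp

lemma pencil_in_pencil_arr [simp]: "pencil c \<in> pencil_arr C T \<longleftrightarrow> c \<in> C"
  by (auto simp: pencil_arr_def)

lemma transversal_in_pencil_arr [simp]: "transversal t \<in> pencil_arr C T \<longleftrightarrow> t \<in> T"
  by (auto simp: pencil_arr_def)

lemma hyperplane_pencil [simp]: "hyperplane 3 (pencil c)"
proof -
  have "vec3 1 c 0 \<noteq> 0" using vec3_simps(1)[of 1 c 0] by (metis zero_fun_apply zero_neq_one)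
  then show ?thesis unfolding hyperplane_def pencil_def by (blast intro: vec3_in_coord_space)
qed

lemma hyperplane_transversal [simp]: "hyperplane 3 (transversal t)"
proof -
  have "vec3 (- t) (- (t\<^sup>2)) 1 \<noteq> 0"
    using vec3_simps(3)[of "- t" "- (t\<^sup>2)" 1] by (metis zero_fun_apply zero_neq_one)
  then show ?thesis unfolding hyperplane_def transversal_def by (blast intro: vec3_in_coord_space)
qed

lemma card_pencil_arr:
  assumes "finite C" "finite T"
  shows "card (pencil_arr C T) = card C + card T"
  unfolding pencil_arr_def using assms
  by (subst card_Un_disjoint) (auto simp: card_image inj_on_def)

lemma restriction_pencil:
  assumes "c \<notin> C" "C \<noteq> {}"
  shows "restriction (pencil_arr C T \<union> {pencil c}) (pencil c) =
    insert axis ((\<lambda>t. ray c (t * (t - c))) ` T)"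
proof -
  have "(\<inter>) (pencil c) ` pencil_arr C T =
      (\<lambda>c'. pencil c \<inter> pencil c') ` C \<union> (\<lambda>t. pencil c \<inter> transversal t) ` T"
    by (simp add: pencil_arr_def image_Un image_image)
  also have "(\<lambda>c'. pencil c \<inter> pencil c') ` C = {axis}"
    using assms pencil_Int_pencil by (metis (no_types, lifting) image_cong image_constant_conv)
  finally show ?thesis
    using assms(1) restriction_insert[of "pencil c" "pencil_arr C T"]
    by (simp add: pencil_Int_transversal)
qed

text \<open>The transversals \<open>s\<close> and \<open>t\<close> cut out the same ray, so besides
  the axis at most \<open>card T - 1\<close> rays remain.\<close>

lemma card_restriction_pencil_le:
  assumes "c \<notin> C" "C \<noteq> {}" "finite T" "s \<in> T" "t \<in> T" "s \<noteq> t" "s + t = c"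
  shows "card (restriction (pencil_arr C T \<union> {pencil c}) (pencil c)) \<le> card T"
proof -
  define f where "f u = ray c (u * (u - c))" for u
  have "f s = f t" using assms(7) by (auto simp: f_def algebra_simps)
  then have "f ` T = f ` (T - {s})" using assms(4-6) by blast
  then have "card (f ` T) \<le> card (T - {s})" using assms(3) by (simp add: card_image_le)
  then have "card (insert axis (f ` T)) \<le> Suc (card (T - {s}))"
    using assms(3) by (simp add: card_insert_if)
  also have "\<dots> = card T" using assms(3,4) by (rule card_Suc_Diff1)
  finally show ?thesis unfolding restriction_pencil[OF assms(1,2)] f_def .
qed

lemma card_restriction_pencil_eq:
  assumes "c \<notin> C" "C \<noteq> {}" "finite T" "\<And>s t. s \<in> T \<Longrightarrow> t \<in> T \<Longrightarrow> s \<noteq> t \<Longrightarrow> s + t \<noteq> c"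
  shows "card (restriction (pencil_arr C T \<union> {pencil c}) (pencil c)) = card T + 1"
proof -
  have "inj_on (\<lambda>t. ray c (t * (t - c))) T"
  proof (rule inj_onI)
    fix s t assume st: "s \<in> T" "t \<in> T" "ray c (s * (s - c)) = ray c (t * (t - c))"
    have "(s - t) * (s + t - c) = s * (s - c) - t * (t - c)" by (simp add: algebra_simps)
    then have "s = t \<or> s + t = c" using st(3) by auto
    then show "s = t" using assms(4) st(1,2) by blast
  qed
  moreover have "axis \<notin> (\<lambda>t. ray c (t * (t - c))) ` T" by auto
  ultimately show ?thesis
    unfolding restriction_pencil[OF assms(1,2)] using assms(3) by (simp add: card_image)
qed

text \<open>A transversal \<open>s\<close> leaves on \<open>transversal t\<close> the same trace as
  the member \<open>t + s\<close>, whether or not that member is present; everything is counted by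
  parameters of the pencil.\<close>

lemma restriction_transversal:
  assumes "t \<notin> T"
  shows "restriction (pencil_arr C T \<union> {transversal t}) (transversal t) =
    (\<lambda>c. ray c (t * (t - c))) ` (C \<union> (+) t ` T)"
proof -
  have "(\<inter>) (transversal t) ` pencil_arr C T =
      (\<lambda>c. transversal t \<inter> pencil c) ` C \<union> (\<lambda>s. transversal t \<inter> transversal s) ` T"
    by (simp add: pencil_arr_def image_Un image_image)
  also have "(\<lambda>s. transversal t \<inter> transversal s) ` T = (\<lambda>s. transversal t \<inter> pencil (t + s)) ` T"
    using assms by (intro image_cong refl transversal_Int_transversal) auto
  finally show ?thesis
    using assms restriction_insert[of "transversal t" "pencil_arr C T"]
    by (simp add: pencil_Int_transversal Int_commute[of "transversal t"] image_Un image_image)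
qed

lemma card_restriction_transversal:
  assumes "t \<notin> T"
  shows "card (restriction (pencil_arr C T \<union> {transversal t}) (transversal t)) =
    card (C \<union> (+) t ` T)"
  unfolding restriction_transversal[OF assms] by (rule card_image) (auto simp: inj_on_def)

section \<open>Codimensions of lines and planes\<close>

lemma coord_space_3_eq: "v \<in> coord_space 3 \<Longrightarrow> v = vec3 (v 0) (v 1) (v 2)"
proof
  fix i assume "v \<in> coord_space 3"
  then show "v i = vec3 (v 0) (v 1) (v 2) i"
    using less_Suc_eq by (cases "i < 3") (auto simp: vec3_def coord_space_def eval_nat_numeral)
qed

lemma scale_vec3: "scale_kvec r (vec3 a b c) = vec3 (r * a) (r * b) (r * c)"
  by (simp add: fun_eq_iff vec3_def)

lemma minus_vec3: "vec3 a b c - vec3 a' b' c' = vec3 (a - a') (b - b') (c - c')"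
  by (simp add: fun_eq_iff vec3_def)

lemma vec3_eq_iff: "vec3 a b c = vec3 a' b' c' \<longleftrightarrow> a = a' \<and> b = b' \<and> c = c'"
  using vec3_simps by metis

lemma vec3_eq_0_iff: "vec3 a b c = 0 \<longleftrightarrow> a = 0 \<and> b = 0 \<and> c = 0"
proof -
  have "0 = vec3 0 0 (0 :: 'a)" by (simp add: fun_eq_iff vec3_def)
  then show ?thesis by (metis vec3_eq_iff)
qed

lemma codim_ray: "codim 3 (ray c w) = 2"
proof -
  let ?b = "vec3 (- c) 1 w"
  have "ray c w = kvec.span {?b}"
  proof -
    have "v \<in> ray c w \<longleftrightarrow> (\<exists>r. v = scale_kvec r ?b)" for v
    proof
      assume v: "v \<in> ray c w"
      then have "v = vec3 (v 0) (v 1) (v 2)" by (intro coord_space_3_eq) (simp add: ray_def)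
      also have "\<dots> = scale_kvec (v 1) ?b" using v by (simp add: ray_def scale_vec3 mult.commute)
      finally show "\<exists>r. v = scale_kvec r ?b" ..
    qed (auto simp: ray_def scale_vec3)
    then show ?thesis by (auto simp: kvec.span_singleton)
  qed
  moreover have "kvec.independent {?b}" by (simp add: kvec.dependent_single vec3_eq_0_iff)
  ultimately have "kvec.dim (ray c w) = 1" by (simp add: kvec.dim_eq_card_independent)
  then show ?thesis by (simp add: codim_def)
qed

lemma codim_pencil: "codim 3 (pencil c) = 1"
proof -
  let ?b = "vec3 (- c) 1 0" and ?e = "vec3 0 0 1 :: 'a kvec"
  have span: "kvec.span {?b, ?e} = pencil c"
  proof -
    have "v \<in> pencil c \<longleftrightarrow> (\<exists>r s. v - scale_kvec r ?b = scale_kvec s ?e)" for v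
    proof
      assume v: "v \<in> pencil c"
      then have "v = vec3 (v 0) (v 1) (v 2)" by (intro coord_space_3_eq) (simp add: mem_pencil)
      then have "v - scale_kvec (v 1) ?b = vec3 (v 0) (v 1) (v 2) - scale_kvec (v 1) ?b" by simp
      also have "\<dots> = scale_kvec (v 2) ?e"
        using v by (simp add: mem_pencil scale_vec3 minus_vec3 mult.commute)
      finally show "\<exists>r s. v - scale_kvec r ?b = scale_kvec s ?e" by blast
    next
      assume "\<exists>r s. v - scale_kvec r ?b = scale_kvec s ?e"
      then obtain r s where "v = scale_kvec s ?e + scale_kvec r ?b" by (auto simp: diff_eq_eq)
      moreover have "?e \<in> pencil c" "?b \<in> pencil c" by (simp_all add: mem_pencil)
      ultimately show "v \<in> pencil c"
        using kvec.subspace_add kvec.subspace_scale subspace_hyperplane[OF hyperplane_pencil] by metis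
    qed
    then show ?thesis by (auto simp: kvec.span_insert kvec.span_singleton)
  qed
  have "?b \<notin> kvec.span {?e}" by (auto simp: kvec.span_singleton scale_vec3 vec3_eq_iff)
  then have "kvec.independent {?b, ?e} \<and> ?b \<noteq> ?e"
    by (simp add: kvec.independent_insert kvec.dependent_single vec3_eq_0_iff vec3_eq_iff)
  then have "kvec.dim (pencil c) = 2"
    unfolding span[symmetric] by (simp add: kvec.dim_eq_card_independent)
  then show ?thesis by (simp add: codim_def)
qed

subsection \<open>MAT2-free steps\<close>

lemma Min_nonzero_pencil_exponents: "Min {i \<in> {1..3}. pencil_exponents m k i \<noteq> 0} \<le> 1"
  by (rule Min_le) (simp_all add: pencil_exponents_def)

lemma exponents_empty_3: "exponents 3 ({} :: 'k::field kvec set set) (\<lambda>_. 0)"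
proof -
  define \<theta> :: "nat \<Rightarrow> 'k mpoly \<Rightarrow> 'k mpoly" where
    "\<theta> i = der3 (if i = 1 then 1 else 0) (if i = 2 then 1 else 0) (if i = 3 then 1 else 0)" for i
  have Der: "\<theta> i \<in> Der 3" for i by (simp add: \<theta>_def)
  have vars: "(\<Sum>i=1..3. g i * \<theta> i x\<^sub>0) = g 1" "(\<Sum>i=1..3. g i * \<theta> i x\<^sub>1) = g 2"
    "(\<Sum>i=1..3. g i * \<theta> i x\<^sub>2) = g 3" for g
    unfolding sum_1_3 by (simp_all add: \<theta>_def)
  have "log_der_basis 3 {} \<theta>"
    unfolding log_der_basis_def
  proof (intro conjI ballI)
    show "\<theta> i \<in> log_der 3 {}" for i using Der by (simp add: log_der_def)
    fix \<eta> :: "'k mpoly \<Rightarrow> 'k mpoly" assume "\<eta> \<in> log_der 3 {}"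
    then have \<eta>: "\<eta> \<in> Der 3" by (rule log_der_Der)
    show "\<exists>!g. g \<in> {1..3} \<rightarrow>\<^sub>E poly_ring 3 \<and> \<eta> = (\<lambda>f. \<Sum>i=1..3. g i * \<theta> i f)"
    proof (rule ex_ex1I)
      define g :: "nat \<Rightarrow> 'k mpoly" where
        "g = (\<lambda>i\<in>{1..3}. if i = 1 then \<eta> x\<^sub>0 else if i = 2 then \<eta> x\<^sub>1 else \<eta> x\<^sub>2)"
      have g: "g 1 = \<eta> x\<^sub>0" "g 2 = \<eta> x\<^sub>1" "g 3 = \<eta> x\<^sub>2" by (simp_all add: g_def)
      have gr: "g \<in> {1..3} \<rightarrow>\<^sub>E poly_ring 3" using Der_in_3[OF \<eta>] by (auto simp: g_def)
      have "\<eta> = (\<lambda>f. \<Sum>i=1..3. g i * \<theta> i f)"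
      proof (rule Der_eqI_3[OF \<eta>])
        show "(\<lambda>f. \<Sum>i=1..3. g i * \<theta> i f) \<in> Der 3"
          using gr Der by (intro Der_combination) auto
      qed (simp_all only: vars g)
      then show "\<exists>g. g \<in> {1..3} \<rightarrow>\<^sub>E poly_ring 3 \<and> \<eta> = (\<lambda>f. \<Sum>i=1..3. g i * \<theta> i f)"
        using gr by blast
    next
      fix g h
      assume g: "g \<in> {1..3} \<rightarrow>\<^sub>E poly_ring 3 \<and> \<eta> = (\<lambda>f. \<Sum>i=1..3. g i * \<theta> i f)"
        and h: "h \<in> {1..3} \<rightarrow>\<^sub>E poly_ring 3 \<and> \<eta> = (\<lambda>f. \<Sum>i=1..3. h i * \<theta> i f)"
      from g h have eq: "(\<Sum>i=1..3. g i * \<theta> i f) = (\<Sum>i=1..3. h i * \<theta> i f)" for f by metis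
      have "g 1 = h 1" "g 2 = h 2" "g 3 = h 3"
        using eq[of "x\<^sub>0"] eq[of "x\<^sub>1"] eq[of "x\<^sub>2"] unfolding vars by blast+
      then have "\<forall>i\<in>{1..3}. g i = h i" unfolding atLeastAtMost_1_3 by simp
      then show "g = h" using g h by (intro PiE_ext) auto
    qed
  qed
  moreover have "homogeneous_der 3 0 (\<theta> i)" for i
    using homogeneous_const[of "1::'k"] by (simp add: homogeneous_der_3 \<theta>_def)
  ultimately show ?thesis by (auto simp: exponents_def mono_on_def)
qed

text \<open>A single step from the empty arrangement with \<open>s = 1\<close>: three independent
  planes meet in the origin only, which the empty union does not cover.\<close>

lemma MAT2_free_initial:
  fixes c c' t :: "'k::field"
  assumes "c \<noteq> c'"
  shows "(3, pencil_arr {c, c'} {t}) \<in> MAT2_free"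
proof -
  define H where "H i = (if i = 1 then pencil c else if i = 2 then pencil c' else transversal t)"
    for i :: nat
  have img: "H ` {1..3} = {pencil c, pencil c', transversal t}"
    unfolding atLeastAtMost_1_3 by (auto simp: H_def)
  have X: "(\<Inter>j\<in>{1..3}. H j) = {0}"
  proof -
    have "(\<Inter>j\<in>{1..3}. H j) = axis \<inter> transversal t"
      unfolding img using pencil_Int_pencil[OF assms] by auto
    also have "\<dots> = {0}"
    proof -
      have "v = 0" if "v \<in> axis \<inter> transversal t" for v
        using that coord_space_3_eq[of v] by (auto simp: axis_def mem_transversal vec3_eq_0_iff)
      then show ?thesis by (auto simp: axis_def mem_transversal coord_space_def)
    qed
    finally show ?thesis .
  qed
  have "kvec.dim {0 :: 'k kvec} = 0"
    using kvec.dim_span[of "{} :: 'k kvec set"] kvec.dim_eq_card_independent[of "{} :: 'k kvec set"]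
    by (simp add: kvec.independent_empty)
  then have codim: "codim 3 {0 :: 'k kvec} = 3" by (simp add: codim_def)
  have "(3, {} \<union> H ` {1..3}) \<in> MAT2_free"
  proof (rule MAT2_free.step)
    show "(3, {}) \<in> MAT2_free" by (rule MAT2_free.empty)
    show "exponents 3 {} (\<lambda>_. 0)" by (rule exponents_empty_3)
    show "\<forall>j\<in>{1..3}. hyperplane 3 (H j) \<and> H j \<notin> {}" by (simp add: H_def)
    show "{0} = (\<Inter>j\<in>{1..3}. H j)" by (rule X[symmetric])
    show "codim 3 {0 :: 'k kvec} = 3 - 1 + 1" by (simp add: codim)
  qed (simp_all add: restriction_def)
  then show ?thesis unfolding img by (simp add: pencil_arr_def insert_commute)
qed

text \<open>Only the largest exponent is raised. All sums already lie in \<open>C\<close>, so the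
  transversals have distinct traces on \<open>pencil c\<close>, and condition (3) reads |C| + |T| -
  (|T| + 1) = |C| - 1.\<close>

lemma MAT2_free_single_step:
  fixes c :: "'k::field_char_0"
  assumes A: "(3, pencil_arr C T) \<in> MAT2_free" and ip: "interpolable c\<^sub>0 C T"
    and card: "1 \<le> card T" "card T < card C" and c: "c \<notin> C"
  shows "(3, pencil_arr (insert c C) T) \<in> MAT2_free"
proof -
  let ?d = "pencil_exponents (card C) (card T)"
  have fin: "finite C" "finite T" "C \<noteq> {}" using ip by (auto simp: interpolable_def)
  have "(3, pencil_arr C T \<union> (\<lambda>_. pencil c) ` {3..3::nat}) \<in> MAT2_free"
  proof (rule MAT2_free.step[OF A exponents_pencil_arr[OF ip card]])
    show "pencil_arr C T \<noteq> {} \<longrightarrow> Min {i \<in> {1..3}. ?d i \<noteq> 0} < 3"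
      using Min_nonzero_pencil_exponents[of "card C" "card T"] by simp
    show "\<forall>j\<in>{3..3::nat}. hyperplane 3 (pencil c) \<and> pencil c \<notin> pencil_arr C T" using c by simp
    show "pencil c = (\<Inter>j\<in>{3..3::nat}. pencil c)" by simp
    show "codim 3 (pencil c) = 3 - 3 + 1" by (simp add: codim_pencil)
    show "\<not> pencil c \<subseteq> \<Union> (pencil_arr C T)"
    proof
      \<comment> \<open>A point of the new member off all transversals needs a height different from
        finitely many values; an infinite field supplies one.\<close>
      have "finite ((\<lambda>t. t * (t - c)) ` T)" using fin by simp
      then obtain w where w: "w \<notin> (\<lambda>t. t * (t - c)) ` T"
        using ex_new_if_finite[OF infinite_UNIV_char_0] by blast
      let ?v = "vec3 (- c) 1 w"
      assume "pencil c \<subseteq> \<Union> (pencil_arr C T)"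
      moreover have v: "?v \<in> pencil c" by (simp add: mem_pencil)
      ultimately consider c' where "c' \<in> C" "?v \<in> pencil c'" | s where "s \<in> T" "?v \<in> transversal s"
        unfolding pencil_arr_def by blast
      then show False
      proof cases
        case 1
        then show False using c by (simp add: mem_pencil)
      next
        case 2
        then have "?v \<in> ray c (s * (s - c))" using v pencil_Int_transversal[of c s] by blast
        then show False using w 2 by (simp add: ray_def)
      qed
    qed
    have "s + t \<noteq> c" if "s \<in> T" "t \<in> T" "s \<noteq> t" for s t
      using ip that c by (auto simp: interpolable_def)
    then have "card (restriction (pencil_arr C T \<union> {pencil c}) (pencil c)) = card T + 1"
      using c fin by (intro card_restriction_pencil_eq) auto
    then show "\<forall>j\<in>{3..3}. int (card (pencil_arr C T)) -
        int (card (restriction (pencil_arr C T \<union> {pencil c}) (pencil c))) = int (?d j)"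
      using card by (simp add: card_pencil_arr[OF fin(1,2)] pencil_exponents_def)
  qed simp_all
  moreover have "pencil_arr C T \<union> (\<lambda>_. pencil c) ` {3..3::nat} = pencil_arr (insert c C) T"
    by (auto simp: pencil_arr_def)
  ultimately show ?thesis by simp
qed

text \<open>The two largest exponents are raised together. The new transversal meets the old ones on
  members already in \<open>C\<close>, so its restriction has |C| elements and accounts for the
  exponent |T|; the new member accounts for |C| - 1 as in a single step.\<close>

lemma MAT2_free_double_step:
  fixes c t :: "'k::field"
  assumes A: "(3, pencil_arr C T) \<in> MAT2_free" and ip: "interpolable c\<^sub>0 C T"
    and card: "1 \<le> card T" "card T < card C" and c: "c \<notin> C" and t: "t \<notin> T" "(+) t ` T \<subseteq> C"
  shows "(3, pencil_arr (insert c C) (insert t T)) \<in> MAT2_free"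
proof -
  let ?d = "pencil_exponents (card C) (card T)"
  have fin: "finite C" "finite T" "C \<noteq> {}" using ip by (auto simp: interpolable_def)
  define H where "H i = (if i = 2 then transversal t else pencil c)" for i :: nat
  have range: "{2..3} = {2, 3::nat}" by auto
  have img: "H ` {2..3} = {transversal t, pencil c}" unfolding range by (auto simp: H_def)
  have X: "(\<Inter>j\<in>{2..3}. H j) = ray c (t * (t - c))"
    unfolding img using pencil_Int_transversal[of c t] by (simp add: Int_commute)
  have "(3, pencil_arr C T \<union> H ` {2..3}) \<in> MAT2_free"
  proof (rule MAT2_free.step[OF A exponents_pencil_arr[OF ip card]])
    show "pencil_arr C T \<noteq> {} \<longrightarrow> Min {i \<in> {1..3}. ?d i \<noteq> 0} < 2"
      using Min_nonzero_pencil_exponents[of "card C" "card T"] by simp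
    show "\<forall>j\<in>{2..3}. hyperplane 3 (H j) \<and> H j \<notin> pencil_arr C T" using c t by (simp add: H_def)
    show "ray c (t * (t - c)) = (\<Inter>j\<in>{2..3}. H j)" by (rule X[symmetric])
    show "codim 3 (ray c (t * (t - c))) = 3 - 2 + 1" by (simp add: codim_ray)
    show "\<not> ray c (t * (t - c)) \<subseteq> \<Union> (pencil_arr C T)"
    proof
      let ?v = "vec3 (- c) 1 (t * (t - c))"
      assume "ray c (t * (t - c)) \<subseteq> \<Union> (pencil_arr C T)"
      moreover have "?v \<in> ray c (t * (t - c))" by (simp add: ray_def)
      ultimately consider c' where "c' \<in> C" "?v \<in> pencil c'" | s where "s \<in> T" "?v \<in> transversal s"
        unfolding pencil_arr_def by blast
      then show False
      proof cases
        case 1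
        then show False using c by (simp add: mem_pencil)
      next
        case 2
        then have "?v \<in> transversal t \<inter> transversal s"
          by (simp add: mem_transversal power2_eq_square algebra_simps)
        \<comment> \<open>An old transversal through this point would force
          \<open>c = t + s\<close>, but \<open>t + s\<close> lies in \<open>C\<close> and
          \<open>c\<close> does not.\<close>
        then have "?v \<in> pencil (t + s)"
          using transversal_Int_transversal[of t s] t 2 by auto
        then have "- c = - ((t + s) * 1)" unfolding mem_pencil by simp
        then have "t + s = c" by (simp only: neg_equal_iff_equal mult_1_right)
        then show False using t c 2 by auto
      qed
    qed
    have "s + u \<noteq> c" if "s \<in> T" "u \<in> T" "s \<noteq> u" for s u
      using ip that c by (auto simp: interpolable_def)
    then have "card (restriction (pencil_arr C T \<union> {pencil c}) (pencil c)) = card T + 1"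
      using c fin by (intro card_restriction_pencil_eq) auto
    moreover have "card (restriction (pencil_arr C T \<union> {transversal t}) (transversal t)) = card C"
      unfolding card_restriction_transversal[OF t(1)] using t(2) by (simp add: Un_absorb2)
    ultimately show "\<forall>j\<in>{2..3}. int (card (pencil_arr C T)) -
        int (card (restriction (pencil_arr C T \<union> {H j}) (H j))) = int (?d j)"
      unfolding range using card by (simp add: card_pencil_arr[OF fin(1,2)] pencil_exponents_def H_def)
  qed simp_all
  moreover have "pencil_arr C T \<union> H ` {2..3} = pencil_arr (insert c C) (insert t T)"
    unfolding img by (auto simp: pencil_arr_def)
  ultimately show ?thesis by simp
qed

subsection \<open>An obstruction to MAT-freeness\<close>

lemma Inter_subset_pencil:
  assumes "pencil c \<in> \<H>" "pencil c' \<in> \<H>" "c \<noteq> c'"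
  shows "\<Inter>\<H> \<subseteq> pencil c''"
proof -
  have "\<Inter>\<H> \<subseteq> pencil c \<inter> pencil c'" using assms by blast
  also have "\<dots> = axis" using assms(3) by (rule pencil_Int_pencil)
  also have "\<dots> \<subseteq> pencil c''" by (auto simp: axis_def mem_pencil)
  finally show ?thesis .
qed

text \<open>In a final MAT step one could only remove a member of the pencil through no intersection of two
  transversals: two members of the pencil violate condition (2), a transversal is excluded by
  \<open>d\<^sub>3 \<ge> |C| - 1\<close>, and a member \<open>s + t\<close> by the sum of the exponents.\<close>

lemma MAT_free_pencil_arrD:
  fixes C S T :: "'k::field set"
  defines "S \<equiv> {s + t |s t. s \<in> T \<and> t \<in> T \<and> s \<noteq> t}"
  assumes fin: "finite T" and c\<^sub>0: "c\<^sub>0 \<notin> S" and card: "card T + 2 \<le> card S" "1 \<le> card T" "4 \<le> card S"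
    and C: "S \<subseteq> C" "C \<subseteq> insert c\<^sub>0 S" and MAT: "(3, pencil_arr C T) \<in> MAT_free"
  shows "C = insert c\<^sub>0 S \<and> (3, pencil_arr S T) \<in> MAT_free"
proof -
  have finS: "finite S"
  proof -
    have "S \<subseteq> (\<lambda>(s, t). s + t) ` (T \<times> T)" by (auto simp: S_def)
    then show ?thesis using fin finite_subset by blast
  qed
  have finC: "finite C" using finite_subset[OF C(2)] finS by simp
  have cardC: "card S \<le> card C" using C(1) finC by (simp add: card_mono)
  have ip: "interpolable c\<^sub>0 (insert c\<^sub>0 S) T"
    using fin finS c\<^sub>0 by (auto simp: interpolable_def S_def)
  from MAT show ?thesis
  proof (cases rule: MAT_free.cases)
    case empty
    have "C \<noteq> {}" using cardC card by auto
    then show ?thesis using empty by (auto simp: pencil_arr_def)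
  next
    case (step A' d p q H X)
    have arr: "pencil_arr C T = A' \<union> H ` {1..q}" using step by auto
    have step': "(3, A') \<in> MAT_free" "exponents 3 A' d" "1 \<le> q" "q \<le> 3"
      "\<forall>j\<in>{1..q}. H j \<notin> A'" "\<not> \<Inter>(H ` {1..q}) \<subseteq> \<Union>A'"
      "\<forall>j\<in>{1..q}. int (card A') - int (card (restriction (A' \<union> {H j}) (H j))) = int (d 3)"
      using step by simp_all
    define C' where "C' = {c\<in>C. pencil c \<in> A'}"
    define T' where "T' = {t\<in>T. transversal t \<in> A'}"
    have A': "A' = pencil_arr C' T'"
    proof
      show "pencil_arr C' T' \<subseteq> A'" by (auto simp: pencil_arr_def C'_def T'_def)
      have "A' \<subseteq> pencil ` C \<union> transversal ` T" using arr unfolding pencil_arr_def by (metis Un_upper1)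
      then show "A' \<subseteq> pencil_arr C' T'" unfolding pencil_arr_def C'_def T'_def by fast
    qed
    have finC': "finite C'" and finT': "finite T'" using fin finC by (simp_all add: C'_def T'_def)
    have removed_pencil: "pencil c \<in> H ` {1..q}" if "c \<in> C - C'" for c
    proof -
      have "pencil c \<in> pencil_arr C T" "pencil c \<notin> A'" using that by (auto simp: C'_def)
      then show ?thesis using arr by blast
    qed
    have removed_transversal: "transversal t \<in> H ` {1..q}" if "t \<in> T - T'" for t
    proof -
      have "transversal t \<in> pencil_arr C T" "transversal t \<notin> A'" using that by (auto simp: T'_def)
      then show ?thesis using arr by blast
    qed
    have count: "int (card A') - int (card (restriction (A' \<union> {K}) K)) = int (d 3)"
      if "K \<in> H ` {1..q}" for K
      using that step'(7) by auto
    have cardCC': "card (C - C') \<le> 3"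
    proof -
      have "card (C - C') = card (pencil ` (C - C'))" by (simp add: card_image inj_on_def)
      also have "\<dots> \<le> card (H ` {1..q})" using removed_pencil by (intro card_mono) auto
      also have "\<dots> \<le> card {1..q}" by (rule card_image_le) simp
      finally show ?thesis using step'(4) by simp
    qed
    have cardC': "card C = card C' + card (C - C')"
      using finC by (simp add: C'_def card_Diff_subset card_mono)
    \<comment> \<open>At most three planes are added in one step and there are at least four
      members, so some member survives. It contains the axis, in which any two removed members would
      meet.\<close>
    then have "C' \<noteq> {}" using cardCC' cardC card by auto
    then obtain c1 where c1: "c1 \<in> C'" by blast
    have single: "c = c'" if "c \<in> C - C'" "c' \<in> C - C'" for c c'
    proof (rule ccontr)
      assume "c \<noteq> c'"
      then have "\<Inter>(H ` {1..q}) \<subseteq> pencil c1"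
        by (intro Inter_subset_pencil[of c _ c'] removed_pencil that)
      moreover have "pencil c1 \<subseteq> \<Union>A'" using c1 by (intro Union_upper) (simp add: C'_def)
      ultimately show False using step'(6) order_trans by metis
    qed
    have "card (C - C') \<le> 1"
      using card_le_Suc0_iff_eq[of "C - C'"] finC single by simp
    note exp = step'(2)[unfolded A']
    note bounds = exponents_lower_bounds[OF exp finC' finT']
    have "T' = T"
    proof (rule ccontr)
      assume "T' \<noteq> T"
      then obtain t where t: "t \<in> T - T'" by (auto simp: T'_def)
      \<comment> \<open>The restriction to a removed transversal has at least |C'| elements, so
        condition (3) gives d3 <= |T'| < |T|. This contradicts d3 >= |C'| - 1 >= |S| - 2 >=
        |T|.\<close>
      have "card C' \<le> card (C' \<union> (+) t ` T')" using finC' finT' by (intro card_mono) auto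
      then have "card C' \<le> card (restriction (A' \<union> {transversal t}) (transversal t))"
        unfolding A' by (subst card_restriction_transversal) (use t in simp_all)
      then have "d 3 \<le> card T'"
        using count[OF removed_transversal[OF t]] by (simp add: A' card_pencil_arr finC' finT')
      moreover have "card T' < card T" using t fin by (intro psubset_card_mono) (auto simp: T'_def)
      ultimately show False
        using bounds(1) cardC' \<open>card (C - C') \<le> 1\<close> cardC card by linarith
    qed
    have "C' \<noteq> C"
    proof
      assume "C' = C"
      then have "H 1 \<in> A'" using \<open>T' = T\<close> A' arr step'(3) by auto
      then show False using step'(3,5) by auto
    qed
    then obtain c where c: "c \<in> C - C'" by (auto simp: C'_def)
    have C': "C' = C - {c}" using single c by (auto simp: C'_def)
    have cC': "card C = card C' + 1" using c finC C' by (metis DiffD1 card.remove Suc_eq_plus1)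
    \<comment> \<open>If \<open>c = s + t\<close>, condition (3) gives d3 >= |C'|. With d2 >= |T|
      and d1 >= 1 the exponents add up to more than |C'| + |T|.\<close>
    have "c \<notin> S"
    proof
      assume "c \<in> S"
      then obtain s t where st: "s \<in> T" "t \<in> T" "s \<noteq> t" "s + t = c" by (auto simp: S_def)
      have "card (restriction (A' \<union> {pencil c}) (pencil c)) \<le> card T"
        unfolding A' \<open>T' = T\<close>
        using card_restriction_pencil_le[OF _ \<open>C' \<noteq> {}\<close> fin st] c by simp
      then have "card C' \<le> d 3"
        using count[OF removed_pencil[OF c]] by (simp add: A' card_pencil_arr finC' fin \<open>T' = T\<close>)
      moreover have "card T \<le> d 2" using bounds(2) cC' cardC card \<open>T' = T\<close> by auto
      moreover have "1 \<le> d 1" using bounds(3) cC' cardC card \<open>T' = T\<close> by auto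
      moreover have "d 1 + d 2 + d 3 \<le> card C' + card T"
        using exp C C' \<open>T' = T\<close> by (intro sum_exponents_le[OF ip]) auto
      ultimately show False by linarith
    qed
    then have "c = c\<^sub>0" using c C by auto
    then have "C' = S" "C = insert c\<^sub>0 S" using C C' c c\<^sub>0 by auto
    then show ?thesis using step'(1) A' \<open>T' = T\<close> by simp
  qed
qed

subsection \<open>The separating arrangement\<close>

text \<open>A transversal enters once its sums with the earlier ones are present: 1 for the
  transversal 1; 2, 3 for 2; 4, 5, 6 for 4. The parameter \<open>c\<^sub>0\<close> is each time a
  present member that is not a sum of present transversals. The exponents run through (1,1,1),
  (1,1,2), (1,1,3), (1,2,4), (1,3,5), (1,4,6).\<close>

lemma pencil_arr_MAT2_free:
  "(3, pencil_arr {0, 1, 2, 3, 4, 5, 6} {0, 1, 2, 4 :: 'k::field_char_0}) \<in> MAT2_free"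
proof -
  have "(3, pencil_arr {1, 2} {0 :: 'k}) \<in> MAT2_free"
    by (rule MAT2_free_initial) simp
  then have "(3, pencil_arr {3, 1, 2} {0 :: 'k}) \<in> MAT2_free"
    by (rule MAT2_free_single_step[where c\<^sub>0 = 1]) (simp_all add: interpolable_def)
  then have "(3, pencil_arr {4, 3, 1, 2} {0 :: 'k}) \<in> MAT2_free"
    by (rule MAT2_free_single_step[where c\<^sub>0 = 1]) (simp_all add: interpolable_def)
  then have "(3, pencil_arr {5, 4, 3, 1, 2} {1, 0 :: 'k}) \<in> MAT2_free"
    by (rule MAT2_free_double_step[where c\<^sub>0 = 1]) (simp_all add: interpolable_def)
  then have "(3, pencil_arr {6, 5, 4, 3, 1, 2} {2, 1, 0 :: 'k}) \<in> MAT2_free"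
    by (rule MAT2_free_double_step[where c\<^sub>0 = 5]) (simp_all add: interpolable_def)
  then have "(3, pencil_arr {0, 6, 5, 4, 3, 1, 2} {4, 2, 1, 0 :: 'k}) \<in> MAT2_free"
    by (rule MAT2_free_double_step[where c\<^sub>0 = 4]) (simp_all add: interpolable_def)
  moreover have "{0, 6, 5, 4, 3, 1, 2} = {0, 1, 2, 3, 4, 5, 6 :: 'k}"
    "{4, 2, 1, 0} = {0, 1, 2, 4 :: 'k}" by auto
  ultimately show ?thesis by simp
qed

lemma pencil_arr_not_MAT_free:
  "(3, pencil_arr {0, 1, 2, 3, 4, 5, 6} {0, 1, 2, 4 :: 'k::field_char_0}) \<notin> MAT_free"
proof
  let ?T = "{0, 1, 2, 4 :: 'k}"
  define S where "S = {s + t |s t. s \<in> ?T \<and> t \<in> ?T \<and> s \<noteq> t}"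
  have S: "S = {1, 2, 3, 4, 5, 6}"
  proof
    show "S \<subseteq> {1, 2, 3, 4, 5, 6}" by (auto simp: S_def)
    have mem: "s + t \<in> S" if "s \<in> ?T" "t \<in> ?T" "s \<noteq> t" for s t
      unfolding S_def using that by blast
    have "1 \<in> S" "2 \<in> S" "3 \<in> S" "4 \<in> S" "5 \<in> S" "6 \<in> S"
      using mem[of 0 1] mem[of 0 2] mem[of 1 2] mem[of 0 4] mem[of 1 4] mem[of 2 4] by simp_all
    then show "{1, 2, 3, 4, 5, 6} \<subseteq> S" by blast
  qed
  note D = MAT_free_pencil_arrD[of ?T 0, folded S_def, unfolded S]
  assume "(3, pencil_arr {0, 1, 2, 3, 4, 5, 6} ?T) \<in> MAT_free"
  then have "(3, pencil_arr {1, 2, 3, 4, 5, 6} ?T) \<in> MAT_free"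
    using D[of "{0, 1, 2, 3, 4, 5, 6}"] by simp
  \<comment> \<open>Applied once more, now to the sums alone, the obstruction demands the member 0
    that has just been removed.\<close>
  then have "{1, 2, 3, 4, 5, 6} = {0, 1, 2, 3, 4, 5, 6 :: 'k}"
    using D[of "{1, 2, 3, 4, 5, 6}"] by simp
  moreover have "0 \<notin> {1, 2, 3, 4, 5, 6 :: 'k}" by simp
  ultimately show False by blast
qed

text \<open>Characteristic 0 enters strictness twice: it keeps 0, ..., 6 distinct, and it makes the
  field infinite, as the choice of a free height in \<open>MAT2_free_single_step\<close>
  requires.\<close>

theorem proposition3p17:
  shows "(MAT_free :: (nat \<times> 'k::field kvec set set) set) \<subseteq> MAT2_free \<and>
    (MAT_free :: (nat \<times> 'c::field_char_0 kvec set set) set) \<subset> MAT2_free"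
proof -
  have "(MAT_free :: (nat \<times> 'k kvec set set) set) \<subseteq> MAT2_free"
    "(MAT_free :: (nat \<times> 'c kvec set set) set) \<subseteq> MAT2_free"
    using MAT_free_imp_MAT2_free by auto
  moreover have "(MAT_free :: (nat \<times> 'c kvec set set) set) \<noteq> MAT2_free"
    using pencil_arr_MAT2_free[where 'k = 'c] pencil_arr_not_MAT_free[where 'k = 'c] by metis
  ultimately show ?thesis by (simp add: psubset_eq)
qed

end
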